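(* Let $k\in\mathbb Z$, $\mathbb N_k=\{l\in\mathbb Z:l\le k\}$, and let $\xi$ be a random variable with $\mathbb P(\xi=l)=p_l$ for $l\in\mathbb N_k$, where $p_l\ge0$, $\sum_{l\in\mathbb N_k}p_l=1$, $p_k\in(0,1)$. Assume $p_kp_{k-1}>0$ and $\mathbb E|\xi|<\infty$. For $N\ge1$ let $\{\xi_{i,j}(s):1\le i,j\le N,s\ge1\}$ be i.i.d. copies of $\xi$, $X(0)\in\mathbb R^N$, $X_i(t+1)=\max_{1\le j\le N}\{X_j(t)+\xi_{i,j}(t+1)\}$, and $v_N=\lim_{t\to\infty}t^{-1}\max_{i\le N}X_i(t)$ (this limit exists a.s. and is deterministic). Then, with $q_k=1-p_k$, as $N\to\infty$, $$v_N=k-q_k^{N^2}2^N+o(q_k^{N^2}2^N).$$ *)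

theory Defs
  imports "HOL-Probability.Probability" "HOL-Library.Landau_Symbols"
begin

fun maxplus_proc :: "nat \<Rightarrow> (nat \<Rightarrow> real) \<Rightarrow> (nat \<Rightarrow> nat \<Rightarrow> nat \<Rightarrow> int) \<Rightarrow> nat \<Rightarrow> nat \<Rightarrow> real" where
  "maxplus_proc N X0 xi 0 i = X0 i"
| "maxplus_proc N X0 xi (Suc t) i =
     Max ((\<lambda>j. maxplus_proc N X0 xi t j + real_of_int (xi i j (Suc t))) ` {1..N})"

end

theory Submission
  imports Defs "HOL-Real_Asymp.Real_Asymp"
begin

text \<open>The front advances by \<open>k\<close> whenever some edge leaving a leader (a particle at the maximum) carries \<open>k\<close>, and otherwise it loses at
  least 1, typically exactly 1. The number of leaders is, between losses, a Markov chain on \<open>{0..N}\<close> which is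
  binomial with parameters \<open>N\<close> and \<open>1 - q ^ z\<close> given \<open>z\<close>, so that \<open>z\<close> leaders lead to a loss with
  probability \<open>q ^ (N z)\<close>. The chain sits at \<open>N\<close> most of the time, and from there the probability of
  passing to \<open>z\<close> and then losing is \<open>\<approx> (N choose z) q ^ (N (N - z)) q ^ (N z)\<close>: all \<open>z\<close>
  contribute the same power of \<open>q\<close>, whence the total \<open>q ^ (N ^ 2) 2 ^ N\<close>.

  For the upper bound on the speed it suffices that from every state the probability of a loss exactly at the
  second step is at least \<open>(1 - o(1)) q ^ (N ^ 2) 2 ^ N\<close>. For the lower bound, a potential function of the number of
  leaders, small at every nonzero state, absorbs the losses outside the state \<open>N\<close>. Fatou's lemma
  transfers both expectation bounds to the almost sure limit.\<close>

section \<open>The binomial chain\<close>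

text \<open>What resists direct computation is the state after a loss: it depends on the values
  below k and on the particles just behind the front. Neither bound describes that state. The upper
  bound on the speed takes the least second-step loss probability over all numbers of leaders. The
  lower bound charges each loss 1 + K, where K bounds the potential at every nonzero state and may
  be any fixed e > 0 once N is large. The two bounds meet because, for large N, the state N
  minimises the second-step loss probability and is also the state where the potential vanishes.
  Losses larger than 1 require every edge leaving a leader to miss both k and k - 1. Positivity of p
  (k - 1) makes the ratio r / q of the probabilities of missing both values and of missing k alone
  less than 1, so such losses are exponentially rarer than losses of 1, and the finite mean controls
  their size. The starting positions are replaced by 0, which keeps all positions integral and so
  separates nonleaders from the front by at least 1.\<close>

definition trans_prob :: "real \<Rightarrow> nat \<Rightarrow> nat \<Rightarrow> nat \<Rightarrow> real" where
  "trans_prob q N z y = real (N choose y) * (1 - q ^ z) ^ y * (q ^ z) ^ (N - y)"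

text \<open>The probability that the chain started at \<open>z\<close> hits \<open>0\<close> exactly at the second step.\<close>

definition hit2 :: "real \<Rightarrow> nat \<Rightarrow> nat \<Rightarrow> real" where
  "hit2 q N z = (\<Sum>y=1..N. trans_prob q N z y * q ^ (N * y))"

lemma trans_prob_nonneg: "0 \<le> q \<Longrightarrow> q \<le> 1 \<Longrightarrow> 0 \<le> trans_prob q N z y"
  by (auto simp: trans_prob_def power_le_one intro!: mult_nonneg_nonneg)

text \<open>\<open>q ^ N\<close> is the probability that all N edges leaving one given leader miss
  k, so y leaders lose ground with probability \<open>(q ^ N) ^ y\<close>: the sum is the generating
  function of the binomial law at \<open>q ^ N\<close>.\<close>

lemma trans_prob_gf: "(\<Sum>y=0..N. trans_prob q N z y * q ^ (N * y)) = (q ^ z + (1 - q ^ z) * q ^ N) ^ N"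
proof -
  have "(q ^ z + (1 - q ^ z) * q ^ N) ^ N = ((1 - q ^ z) * q ^ N + q ^ z) ^ N"
    by (simp add: add.commute)
  also have "\<dots> = (\<Sum>y\<le>N. of_nat (N choose y) * ((1 - q ^ z) * q ^ N) ^ y * (q ^ z) ^ (N - y))"
    by (rule binomial_ring)
  also have "\<dots> = (\<Sum>y=0..N. trans_prob q N z y * q ^ (N * y))"
    by (intro sum.cong) (auto simp: trans_prob_def power_mult_distrib power_mult atLeast0AtMost)
  finally show ?thesis ..
qed

text \<open>Removing the term y = 0 from the generating function removes the paths that lose ground
  already at the first step.\<close>

lemma hit2_eq: "hit2 q N z = (q ^ z + (1 - q ^ z) * q ^ N) ^ N - (q ^ z) ^ N"
proof -
  have "(\<Sum>y=0..N. trans_prob q N z y * q ^ (N * y)) = trans_prob q N z 0 * q ^ (N * 0) + hit2 q N z"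
    unfolding hit2_def by (simp add: sum.atLeast_Suc_atMost)
  thus ?thesis
    using trans_prob_gf[of q N z] by (simp add: trans_prob_def)
qed

text \<open>Compares a loss at the second step with one at the first, of probability
  \<open>q ^ (N * y)\<close>. The remaining factor is small unless y is within logarithmic distance
  of N.\<close>

lemma hit2_le:
  assumes "0 < q" "q < 1" "y \<le> N"
  shows "hit2 q N y \<le> q ^ (N * y) * ((1 + q ^ (N - y)) ^ N - 1)"
proof -
  have "(q ^ y + (1 - q ^ y) * q ^ N) ^ N \<le> (q ^ y + q ^ N) ^ N"
    using assms by (intro power_mono add_mono mult_left_le_one_le add_nonneg_nonneg mult_nonneg_nonneg)
      (auto simp: power_le_one)
  also have "q ^ y + q ^ N = q ^ y * (1 + q ^ (N - y))"
    using assms by (simp add: distrib_left flip: power_add)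
  also have "(q ^ y * (1 + q ^ (N - y))) ^ N = q ^ (N * y) * (1 + q ^ (N - y)) ^ N"
    by (simp add: power_mult_distrib mult.commute flip: power_mult)
  finally show ?thesis
    by (simp add: hit2_eq right_diff_distrib mult.commute flip: power_mult)
qed

text \<open>\<open>a ^ n - b ^ n\<close> is \<open>a - b\<close> times a sum of nonnegative
  products, of which only \<open>a ^ (n - 1)\<close> is kept.\<close>

lemma power_diff_ge:
  fixes a b :: real
  assumes "0 \<le> b" "b \<le> a" "n > 0"
  shows "(a - b) * a ^ (n - 1) \<le> a ^ n - b ^ n"
proof -
  have "b * b ^ (n - 1) \<le> b * a ^ (n - 1)"
    using assms by (intro mult_left_mono power_mono) auto
  then show ?thesis
    using assms by (cases n) (auto simp: algebra_simps)
qed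

text \<open>Only z = N is critical: there the closed form is
  \<open>q ^ N\<^sup>2 * ((2 - q ^ N) ^ N - 1)\<close>. For z < N the base of the N-th power exceeds
  \<open>c * q ^ N\<close> with a fixed c > 2, so an exponential surplus over \<open>2 ^ N\<close>
  remains.\<close>

lemma eventually_hit2_ge:
  fixes q e :: real
  assumes q: "0 < q" "q < 1" and e: "e > 0"
  shows "\<forall>\<^sub>F N in sequentially. \<forall>z\<in>{1..N}. (1 - e) * (q ^ N\<^sup>2 * 2 ^ N) \<le> hit2 q N z"
proof -
  \<comment> \<open>The midpoint of 2 and 1 + 1/q, the latter being the limit of the base divided by
    \<open>q ^ N\<close> in the least favourable case z = N - 1.\<close>
  define c where "c = (2 + (1 + 1/q)) / 2"
  have c: "c > 2" "c < 1 + 1 / q"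
    using q by (auto simp: c_def field_simps)
  have "(\<lambda>N. q ^ (N - 1)) \<longlonglongrightarrow> 0"
    using q by real_asymp
  hence "\<forall>\<^sub>F N in sequentially. q ^ (N - 1) < 1 + 1/q - c"
    using c by (intro order_tendstoD) auto
  moreover have "filterlim (\<lambda>N. (1 - q) * c ^ (N-1) / 2 ^ N) at_top sequentially"
    using q c by real_asymp
  hence "\<forall>\<^sub>F N in sequentially. 1 \<le> (1 - q) * c ^ (N-1) / 2 ^ N"
    unfolding filterlim_at_top by blast
  moreover have "(\<lambda>N. real N * q ^ N / 2) \<longlonglongrightarrow> 0" "(\<lambda>N. 1 / 2 ^ N :: real) \<longlonglongrightarrow> 0"
    using q by real_asymp+
  hence "(\<lambda>N. real N * q ^ N / 2 + 1 / 2 ^ N) \<longlonglongrightarrow> 0"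
    by (rule tendsto_add_zero)
  hence "\<forall>\<^sub>F N in sequentially. N * q ^ N / 2 + 1 / 2 ^ N < e"
    using e by (intro order_tendstoD) auto
  ultimately show ?thesis
    using eventually_gt_at_top[of 0]
  proof eventually_elim
    case (elim N)
    show ?case
    proof
      fix z assume z: "z \<in> {1..N}"
      show "(1 - e) * (q ^ N\<^sup>2 * 2 ^ N) \<le> hit2 q N z"
      proof (cases "z = N")
        case True
        have "1 - real N * (q ^ N / 2) \<le> (1 - q ^ N / 2) ^ N"
          using Bernoulli_inequality[of "- (q ^ N / 2)" N] q power_le_one[of q N] by simp
        hence "(1 - real N * (q ^ N / 2)) * 2 ^ N \<le> (1 - q ^ N / 2) ^ N * 2 ^ N"
          by (intro mult_right_mono) auto
        also have "\<dots> = (2 - q ^ N) ^ N"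
          by (simp flip: power_mult_distrib)
        finally have 1: "(1 - real N * (q ^ N / 2)) * 2 ^ N - 1 \<le> (2 - q ^ N) ^ N - 1"
          by simp
        \<comment> \<open>The two error terms: Bernoulli's inequality costs
          \<open>N * q ^ N / 2\<close>, and excluding a loss at the first step costs
          \<open>1 / 2 ^ N\<close>.\<close>
        have "(1 - e) * 2 ^ N \<le> (1 - (N * q ^ N / 2 + 1 / 2 ^ N)) * 2 ^ N"
          using elim by (intro mult_right_mono) auto
        also have "\<dots> = (1 - real N * (q ^ N / 2)) * 2 ^ N - 1"
          by (simp add: field_simps)
        finally have "(1 - e) * 2 ^ N \<le> (2 - q ^ N) ^ N - 1"
          using 1 by linarith
        hence "q ^ N\<^sup>2 * ((1 - e) * 2 ^ N) \<le> q ^ N\<^sup>2 * ((2 - q ^ N) ^ N - 1)"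
          using q by (intro mult_left_mono) auto
        also have "\<dots> = (q ^ N * (2 - q ^ N)) ^ N - (q ^ N) ^ N"
          unfolding power_mult_distrib by (simp add: power2_eq_square right_diff_distrib power_mult)
        also have "q ^ N * (2 - q ^ N) = q ^ N + (1 - q ^ N) * q ^ N"
          by (simp add: algebra_simps)
        finally show ?thesis
          using True by (simp add: hit2_eq mult_ac)
      next
        case False
        define a where "a = q ^ z + (1 - q ^ z) * q ^ N"
        have zle: "q ^ z \<le> q"
          using q z power_decreasing[of 1 z q] by simp
        have N: "q ^ N = q * q ^ (N - 1)"
          using elim by (cases N) auto
        have "q ^ N * c \<le> q ^ N * (1 + 1/q - q ^ (N - 1))"
          using q elim by (intro mult_left_mono) auto
        also have "\<dots> = q ^ N + (1 - q ^ N) * q ^ (N - 1)"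
          using q N by (simp add: field_simps)
        \<comment> \<open>The base is symmetric under exchanging z and N. In this form z occurs only
          in \<open>q ^ z\<close>, which for z < N is least at z = N - 1.\<close>
        also have "\<dots> \<le> q ^ N + (1 - q ^ N) * q ^ z"
          using q z False by (intro add_left_mono mult_left_mono power_decreasing) (auto simp: power_le_one)
        also have "\<dots> = a"
          by (simp add: a_def algebra_simps)
        finally have a: "q ^ N * c \<le> a" .
        have "(1 - e) * (q ^ N\<^sup>2 * 2 ^ N) \<le> 1 * (q ^ N\<^sup>2 * 2 ^ N)"
          using q e by (intro mult_right_mono) auto
        also have "\<dots> \<le> q ^ N\<^sup>2 * ((1 - q) * c ^ (N - 1))"
        proof -
          have "2 ^ N \<le> (1 - q) * c ^ (N - 1)"
            using elim by (simp add: field_simps)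
          thus ?thesis
            using q by (simp add: mult_left_mono)
        qed
        also have N2: "q ^ N\<^sup>2 = q ^ N * (q ^ N) ^ (N - 1)"
          using elim by (simp add: power2_eq_square power_mult flip: power_Suc)
        also have "q ^ N * (q ^ N) ^ (N - 1) * ((1 - q) * c ^ (N - 1)) = (1 - q) * q ^ N * (q ^ N * c) ^ (N - 1)"
          by (simp add: power_mult_distrib mult_ac)
        also have "\<dots> \<le> (1 - q ^ z) * q ^ N * a ^ (N - 1)"
          using q c a zle by (intro mult_mono power_mono) (auto simp: power_le_one)
        also have "\<dots> = (a - q ^ z) * a ^ (N - 1)"
          by (simp add: a_def)
        also have "\<dots> \<le> a ^ N - (q ^ z) ^ N"
          using q elim by (intro power_diff_ge) (auto simp: a_def power_le_one)
        finally show ?thesis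
          by (simp add: hit2_eq a_def N2)
      qed
    qed
  qed
qed


section \<open>Losses at the third step and the potential function\<close>

text \<open>The exponent identity z (N - y) + N y = z N + (N - z) y extracts a power of q free of y.
  What is left are binomial weights with ratio \<open>(1 - q ^ z) * q ^ (N - z)\<close>, the
  \<open>\<beta>\<close> of the next estimates.\<close>

lemma trans_prob_weight:
  assumes "z \<le> N" "y \<le> N"
  shows "trans_prob q N z y * q ^ (N * y) =
    q ^ (z * N) * (real (N choose y) * ((1 - q ^ z) * q ^ (N - z)) ^ y)"
proof -
  have "z * (N - y) + N * y = z * N + (N - z) * y"
  proof -
    obtain a b where "N = z + a" "N = y + b"
      using assms le_Suc_ex by metis
    hence "int z * (int N - int y) + int N * int y = int z * int N + (int N - int z) * int y"
      by (simp add: algebra_simps)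
    thus ?thesis
      using assms by (metis (no_types) of_nat_add of_nat_diff of_nat_eq_iff of_nat_mult)
  qed
  hence "q ^ (z * (N - y)) * q ^ (N * y) = q ^ (z * N) * q ^ ((N - z) * y)"
    by (simp flip: power_add)
  thus ?thesis
    by (simp add: trans_prob_def power_mult_distrib flip: power_mult)
qed

text \<open>The largest of N + 1 entries summing to \<open>2 ^ N\<close> is at least their mean. The
  polynomial loss is immaterial against exponential gains.\<close>

lemma central_binomial_ge: "2 ^ N / (real N + 1) \<le> real (N choose (N div 2))"
proof -
  have "2 ^ N = (\<Sum>k\<le>N. N choose k)"
    by (simp add: choose_row_sum)
  also have "\<dots> \<le> (\<Sum>k\<le>N. N choose (N div 2))"
    by (intro sum_mono binomial_maximum)
  finally have "2 ^ N \<le> (N + 1) * (N choose (N div 2))"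
    by simp
  hence "real (2 ^ N) \<le> real ((N + 1) * (N choose (N div 2)))"
    by (rule of_nat_mono)
  thus ?thesis
    by (simp add: field_simps)
qed

text \<open>The far end \<open>y > N - L\<close>, where the second factor is large, carries exponentially less weight than
  the centre \<open>y = N div 2\<close>.\<close>

lemma binomial_weight_split:
  fixes q \<beta> :: real
  assumes q: "0 < q" "q < 1" and \<beta>: "0 \<le> \<beta>" "\<beta> \<le> 1" and L: "2 * L < N" "2 \<le> N"
  shows "(\<Sum>y=1..N-1. real (N choose y) * \<beta> ^ y * ((1 + q ^ (N - y)) ^ N - 1))
    \<le> ((1 + q ^ L) ^ N - 1 + (real N + 1) * (real N * (real N ^ L * (1 + q) ^ N) / 2 ^ N))
        * (\<Sum>y=1..N. real (N choose y) * \<beta> ^ y)"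
proof -
  define w where "w y = real (N choose y) * \<beta> ^ y" for y
  define B where "B y = (1 + q ^ (N - y)) ^ N - 1" for y
  define T where "T = real N ^ L * (1 + q) ^ N"
  have w0: "0 \<le> w y" and B0: "0 \<le> B y" for y
    using \<beta> q by (auto simp: w_def B_def)
  have *: "w y * B y \<le> B (N - L) * w y + \<beta> ^ (N div 2) * T" if y: "y \<in> {1..N-1}" for y
  proof (cases "y \<le> N - L")
    case True
    have "B y \<le> B (N - L)"
      unfolding B_def using q True y
      by (intro diff_right_mono power_mono add_left_mono power_decreasing) auto
    hence "w y * B y \<le> B (N - L) * w y"
      using w0[of y] mult_right_mono[of "B y" "B (N - L)" "w y"] by (simp add: mult.commute)
    thus ?thesis
      using \<beta> q by (simp add: T_def add_increasing2)
  next
    case False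
    have "real (N choose y) = real (N choose (N - y))"
      using y by (subst binomial_symmetric) auto
    also have "\<dots> \<le> real (N ^ (N - y))"
      by (intro of_nat_mono binomial_le_pow) auto
    also have "\<dots> \<le> real N ^ L"
      unfolding of_nat_power using False y L by (intro power_increasing) auto
    finally have 1: "real (N choose y) \<le> real N ^ L" .
    \<comment> \<open>This comparison makes the estimate uniform in \<open>\<beta>\<close>, which
      may be exponentially small in N: beyond the centre its powers only decrease.\<close>
    have 2: "\<beta> ^ y \<le> \<beta> ^ (N div 2)"
      using False L \<beta> by (intro power_decreasing) auto
    \<comment> \<open>Here y < N matters: it gives the base 1 + q < 2, hence exponential decay after
      division by \<open>2 ^ N\<close>. At y = N the factor would be \<open>2 ^ N - 1\<close> and
      nothing would be gained.\<close>
    have "q ^ (N - y) \<le> q ^ 1"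
      using q y by (intro power_decreasing) auto
    hence "(1 + q ^ (N - y)) ^ N \<le> (1 + q) ^ N"
      using q by (intro power_mono) auto
    hence 3: "B y \<le> (1 + q) ^ N"
      by (simp add: B_def)
    have "w y * B y \<le> (real N ^ L * \<beta> ^ (N div 2)) * (1 + q) ^ N"
      unfolding w_def using 1 2 3 \<beta> q B0[of y] by (intro mult_mono) auto
    thus ?thesis
      using w0[of y] B0[of "N-L"] by (simp add: T_def mult_ac add_increasing)
  qed
  have W: "\<beta> ^ (N div 2) \<le> (real N + 1) / 2 ^ N * (\<Sum>y=1..N. w y)"
  proof -
    have "2 ^ N / (real N + 1) * \<beta> ^ (N div 2) \<le> w (N div 2)"
      unfolding w_def using central_binomial_ge \<beta> by (intro mult_right_mono) auto
    also have "\<dots> \<le> (\<Sum>y=1..N. w y)"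
      using L w0 by (intro member_le_sum) auto
    finally show ?thesis
      by (simp add: field_simps)
  qed
  have "(\<Sum>y=1..N-1. w y * B y) \<le> (\<Sum>y=1..N-1. B (N - L) * w y + \<beta> ^ (N div 2) * T)"
    by (intro sum_mono *)
  also have "\<dots> = B (N - L) * (\<Sum>y=1..N-1. w y) + real (N - 1) * (\<beta> ^ (N div 2) * T)"
    by (simp add: sum.distrib sum_distrib_left)
  also have "\<dots> \<le> B (N - L) * (\<Sum>y=1..N. w y) + real N * (((real N + 1) / 2 ^ N * (\<Sum>y=1..N. w y)) * T)"
    using W q \<beta> w0 by (intro add_mono mult_left_mono mult_right_mono mult_mono sum_mono2)
      (auto simp: T_def B0)
  also have "\<dots> = (B (N - L) + (real N + 1) * (real N * T / 2 ^ N)) * (\<Sum>y=1..N. w y)"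
    by (simp add: algebra_simps)
  finally show ?thesis
    using L by (simp add: w_def B_def T_def)
qed

text \<open>Losing ground at the third step without returning to \<open>N\<close> leaders is negligible compared with losing
  it at the second one, uniformly in the initial number of leaders.\<close>

lemma eventually_hit3_small:
  fixes q e :: real
  assumes q: "0 < q" "q < 1" and e: "e > 0"
  shows "\<forall>\<^sub>F N in sequentially. \<forall>z\<in>{1..N}.
    (\<Sum>y=1..N-1. trans_prob q N z y * hit2 q N y) \<le> e * hit2 q N z"
proof -
  have "(\<lambda>N. (1 + q powr (sqrt (real N) - 1)) ^ N - 1 +
      (real N + 1) * (real N * (real N powr (sqrt (real N)) * (1 + q) ^ N) / 2^N)) \<longlonglongrightarrow> 0"
    using q by real_asymp
  hence "\<forall>\<^sub>F N in sequentially. (1 + q powr (sqrt (real N) - 1)) ^ N - 1 +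
      (real N + 1) * (real N * (real N powr (sqrt (real N)) * (1 + q) ^ N) / 2^N) < e"
    using e by (intro order_tendstoD) auto
  moreover have "\<forall>\<^sub>F N in sequentially. 2 * sqrt (real N) < real N"
    by real_asymp
  ultimately show ?thesis
    using eventually_ge_at_top[of 2]
  proof eventually_elim
    case (elim N)
    \<comment> \<open>The cut must lie well above log N, so that \<open>N * q ^ L\<close> vanishes,
      and well below N / log N, so that \<open>N ^ L\<close> does not spoil the decay of
      \<open>((1 + q) / 2) ^ N\<close>. The square root of N does both.\<close>
    define L where "L = nat \<lfloor>sqrt (real N)\<rfloor>"
    have L: "real L \<le> sqrt (real N)" "sqrt (real N) - 1 \<le> real L"
      by (auto simp: L_def)
    have L2: "2 * L < N"
      using L elim by linarith
    have "q ^ L \<le> q powr (sqrt (real N) - 1)"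
      using q L by (simp add: powr_mono' flip: powr_realpow)
    moreover have "real N ^ L \<le> real N powr (sqrt (real N))"
      using elim L by (simp add: powr_mono flip: powr_realpow)
    ultimately have "(1 + q ^ L) ^ N - 1 + (real N + 1) * (real N * (real N ^ L * (1 + q) ^ N) / 2 ^ N)
      \<le> (1 + q powr (sqrt (real N) - 1)) ^ N - 1 +
      (real N + 1) * (real N * (real N powr (sqrt (real N)) * (1 + q) ^ N) / 2^N)"
      using q by (intro add_mono diff_right_mono power_mono mult_left_mono divide_right_mono mult_right_mono) auto
    with elim have le: "(1 + q ^ L) ^ N - 1 + (real N + 1) * (real N * (real N ^ L * (1 + q) ^ N) / 2 ^ N) \<le> e"
      by linarith
    show ?case
    proof
      fix z assume z: "z \<in> {1..N}"
      define \<beta> where "\<beta> = (1 - q ^ z) * q ^ (N - z)"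
      have \<beta>: "0 \<le> \<beta>" "\<beta> \<le> 1"
        using q by (auto simp: \<beta>_def power_le_one intro!: mult_le_one)
      have "(\<Sum>y=1..N-1. trans_prob q N z y * hit2 q N y)
        \<le> (\<Sum>y=1..N-1. trans_prob q N z y * (q ^ (N * y) * ((1 + q ^ (N - y)) ^ N - 1)))"
        using q by (intro sum_mono mult_left_mono hit2_le trans_prob_nonneg) auto
      also have "\<dots> = (\<Sum>y=1..N-1. q ^ (z * N) * (real (N choose y) * \<beta> ^ y * ((1 + q ^ (N - y)) ^ N - 1)))"
      proof (intro sum.cong refl)
        fix y assume "y \<in> {1..N-1}"
        thus "trans_prob q N z y * (q ^ (N * y) * ((1 + q ^ (N - y)) ^ N - 1)) =
          q ^ (z * N) * (real (N choose y) * \<beta> ^ y * ((1 + q ^ (N - y)) ^ N - 1))"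
          using trans_prob_weight[of z N y q] z le_trans[of y "N - 1" N] by (simp add: \<beta>_def flip: mult.assoc)
      qed
      also have "\<dots> = q ^ (z * N) * (\<Sum>y=1..N-1. real (N choose y) * \<beta> ^ y * ((1 + q ^ (N - y)) ^ N - 1))"
        by (simp add: sum_distrib_left)
      also have "\<dots> \<le> q ^ (z * N) * (e * (\<Sum>y=1..N. real (N choose y) * \<beta> ^ y))"
        using q \<beta> L2 elim
        by (intro mult_left_mono order.trans[OF binomial_weight_split mult_right_mono[OF le]] sum_nonneg) auto
      also have "\<dots> = e * (\<Sum>y=1..N. q ^ (z * N) * (real (N choose y) * \<beta> ^ y))"
        by (simp add: sum_distrib_left mult_ac)
      also have "(\<Sum>y=1..N. q ^ (z * N) * (real (N choose y) * \<beta> ^ y)) = hit2 q N z"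
        unfolding hit2_def \<beta>_def using z by (intro sum.cong refl trans_prob_weight[symmetric]) auto
      finally show "(\<Sum>y=1..N-1. trans_prob q N z y * hit2 q N y) \<le> e * hit2 q N z" .
    qed
  qed
qed

text \<open>The potential \<open>H\<close> dominates the probability of losing ground before the next visit to \<open>N\<close> leaders; the
  losses up to time 2, inflated by constant factors, already satisfy the required drift inequality.\<close>

lemma eventually_lyapunov:
  fixes q e :: real
  assumes q: "0 < q" "q < 1" and e: "0 < e" "e \<le> 1"
  shows "\<forall>\<^sub>F N in sequentially. \<exists>H :: nat \<Rightarrow> real. (\<forall>y. 0 \<le> H y) \<and> (\<forall>y\<in>{1..N}. H y \<le> e) \<and>
    (\<forall>z\<in>{1..N}. q ^ (N * z) * (1 + 2 * e) + (\<Sum>y=1..N. trans_prob q N z y * H y)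
       \<le> H z + (1 + 2 * e) * (1 + e) * (q ^ N\<^sup>2 * 2 ^ N))"
proof -
  \<comment> \<open>The 6 comes from H \<le> 3 h and h \<le> 2 (f + g), both using e \<le> 1, while
    f + g is at most \<open>(q + q ^ N) ^ N\<close> at every nonzero state.\<close>
  have "(\<lambda>N. 6 * (q + q ^ N) ^ N) \<longlonglongrightarrow> 0"
    using q by real_asymp
  hence "\<forall>\<^sub>F N in sequentially. 6 * (q + q ^ N) ^ N < e"
    using e by (intro order_tendstoD) auto
  moreover have "\<forall>\<^sub>F N in sequentially. \<forall>z\<in>{1..N}.
    (\<Sum>y=1..N-1. trans_prob q N z y * hit2 q N y) \<le> (e / 2) * hit2 q N z"
    using q e by (intro eventually_hit3_small) auto
  ultimately show ?thesis
    using eventually_gt_at_top[of 0]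
  proof eventually_elim
    case (elim N)
    define f where "f z = q ^ (N * z)" for z
    define g where "g z = hit2 q N z" for z
    \<comment> \<open>A loss at the first step plus a loss at the second, the latter with a surplus
      e that pays for the later ones: by \<open>eventually_hit3_small\<close>, moving on one step
      turns the g-part into at most \<open>(1 + e) * (e / 2) * g z\<close>, hence at most
      \<open>e * g z\<close>.\<close>
    define h where "h z = f z + (1 + e) * g z" for z
    \<comment> \<open>Since H vanishes at N, a step starting there has to be paid for by the
      constant on the right of the drift inequality; at every other state H itself pays.\<close>
    define H where "H z = (if z = N then 0 else (1 + 2 * e) * h z)" for z
    have f0: "0 \<le> f z" for z
      using q by (simp add: f_def)
    have g0: "0 \<le> g z" for z
      unfolding g_def hit2_def using q by (intro sum_nonneg mult_nonneg_nonneg trans_prob_nonneg) auto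
    have H0: "0 \<le> H y" for y
      using e f0 g0 by (simp add: H_def h_def)
    have fg: "f z + g z = (q ^ z + (1 - q ^ z) * q ^ N) ^ N" for z
      by (simp add: f_def g_def hit2_eq mult.commute flip: power_mult)
    have sumH: "(\<Sum>y=1..N. trans_prob q N z y * H y) \<le> (1 + 2 * e) * ((1 + e) * g z)" if "z \<in> {1..N}" for z
    proof -
      have "{1..N} = insert N {1..N-1}"
        using elim by auto
      hence "(\<Sum>y=1..N. trans_prob q N z y * H y) = (\<Sum>y=1..N-1. trans_prob q N z y * H y)"
        using elim by (simp add: H_def)
      also have "\<dots> = (\<Sum>y=1..N-1. (1 + 2 * e) * (trans_prob q N z y * f y) +
          (1 + 2 * e) * ((1 + e) * (trans_prob q N z y * g y)))"
        by (intro sum.cong) (auto simp: H_def h_def algebra_simps)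
      also have "\<dots> = (1 + 2 * e) * ((\<Sum>y=1..N-1. trans_prob q N z y * f y) +
          (1 + e) * (\<Sum>y=1..N-1. trans_prob q N z y * g y))"
        by (simp add: sum.distrib sum_distrib_left distrib_left)
      also have "\<dots> \<le> (1 + 2 * e) * (g z + (1 + e) * ((e / 2) * g z))"
      proof (intro mult_left_mono add_mono)
        show "(\<Sum>y=1..N-1. trans_prob q N z y * f y) \<le> g z"
          unfolding g_def hit2_def f_def using q
          by (intro sum_mono2 mult_nonneg_nonneg trans_prob_nonneg) auto
      qed (use e elim that in \<open>auto simp: g_def\<close>)
      also have "\<dots> \<le> (1 + 2 * e) * (g z + e * g z)"
      proof -
        have "(1 + e) * (e / 2) * g z \<le> e * g z"
          using e g0[of z] by (intro mult_right_mono) (auto simp: field_simps)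
        thus ?thesis
          using e by (intro mult_left_mono) (auto simp: mult.assoc)
      qed
      finally show ?thesis
        by (simp add: algebra_simps)
    qed
    show ?case
    proof (intro exI[of _ H] conjI ballI allI)
      fix y assume y: "y \<in> {1..N}"
      have "q ^ y \<le> q"
        using q y power_decreasing[of 1 y q] by simp
      hence "f y + g y \<le> (q + 1 * q ^ N) ^ N"
        unfolding fg using q
        by (intro power_mono add_mono mult_right_mono add_nonneg_nonneg mult_nonneg_nonneg)
           (auto simp: power_le_one)
      moreover have "h y \<le> 2 * (f y + g y)"
        using e f0[of y] mult_right_mono[of e 1 "g y"] g0[of y] by (simp add: h_def algebra_simps)
      moreover have "(1 + 2 * e) * h y \<le> 3 * h y"
        using e f0 g0 by (intro mult_right_mono) (auto simp: h_def)
      ultimately show "H y \<le> e"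
        using elim e by (auto simp: H_def)
    next
      fix z assume z: "z \<in> {1..N}"
      show "q ^ (N * z) * (1 + 2 * e) + (\<Sum>y=1..N. trans_prob q N z y * H y)
         \<le> H z + (1 + 2 * e) * (1 + e) * (q ^ N\<^sup>2 * 2 ^ N)"
      proof (cases "z = N")
        case False
        have "0 \<le> (1 + 2 * e) * (1 + e) * (q ^ N\<^sup>2 * 2 ^ N)"
          using e q by simp
        thus ?thesis
          using sumH[OF z] False by (simp add: H_def h_def f_def algebra_simps)
      next
        case True
        have "f N + g N = (q ^ N * (2 - q ^ N)) ^ N"
          unfolding fg by (simp add: algebra_simps)
        also have "\<dots> \<le> (q ^ N * 2) ^ N"
          using q by (intro power_mono mult_left_mono mult_nonneg_nonneg) (auto simp: power_le_one order.trans[OF _ one_le_numeral])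
        also have "\<dots> = q ^ N\<^sup>2 * 2 ^ N"
          by (simp add: power_mult_distrib power2_eq_square flip: power_mult)
        finally have "f N + g N \<le> q ^ N\<^sup>2 * 2 ^ N" .
        hence "(1 + 2 * e) * (1 + e) * (f N + g N) \<le> (1 + 2 * e) * (1 + e) * (q ^ N\<^sup>2 * 2 ^ N)"
          using e by (intro mult_left_mono) auto
        moreover have "f N * (1 + 2 * e) \<le> (1 + 2 * e) * (1 + e) * f N"
          using e f0[of N] by (simp add: algebra_simps)
        ultimately show ?thesis
          using sumH[OF z] True H0[of N] by (simp add: f_def algebra_simps)
      qed
    qed (use H0 in auto)
  qed
qed

section \<open>The front of the max-plus process\<close>

definition top_pos :: "nat \<Rightarrow> (nat \<Rightarrow> real) \<Rightarrow> (nat \<Rightarrow> nat \<Rightarrow> nat \<Rightarrow> int) \<Rightarrow> nat \<Rightarrow> real" where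
  "top_pos N X0 e t = Max ((\<lambda>i. maxplus_proc N X0 e t i) ` {1..N})"

definition leaders :: "nat \<Rightarrow> (nat \<Rightarrow> real) \<Rightarrow> (nat \<Rightarrow> nat \<Rightarrow> nat \<Rightarrow> int) \<Rightarrow> nat \<Rightarrow> nat set" where
  "leaders N X0 e t = {i \<in> {1..N}. maxplus_proc N X0 e t i = top_pos N X0 e t}"

text \<open>Takes the source set and a single time slice as separate arguments: later the first
  comes from the past and the second is independent of it.\<close>

definition successors :: "nat \<Rightarrow> int \<Rightarrow> nat set \<Rightarrow> (nat \<Rightarrow> nat \<Rightarrow> int) \<Rightarrow> nat set" where
  "successors N k A x = {i \<in> {1..N}. \<exists>j\<in>A. x i j = k}"

abbreviation next_leaders :: "nat \<Rightarrow> int \<Rightarrow> (nat \<Rightarrow> real) \<Rightarrow> (nat \<Rightarrow> nat \<Rightarrow> nat \<Rightarrow> int) \<Rightarrow> nat \<Rightarrow> nat set" where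
  "next_leaders N k X0 e t \<equiv> successors N k (leaders N X0 e t) (\<lambda>i j. e i j (Suc t))"

lemma leaders_subset: "leaders N X0 e t \<subseteq> {1..N}"
  by (auto simp: leaders_def)

lemma leaders_mem: "j \<in> leaders N X0 e t \<Longrightarrow> j \<in> {1..N}"
  by (simp add: leaders_def)

lemma maxplus_le_top: "i \<in> {1..N} \<Longrightarrow> maxplus_proc N X0 e t i \<le> top_pos N X0 e t"
  by (auto simp: top_pos_def)

lemma leaders_nonempty:
  assumes "N \<ge> 1"
  shows "leaders N X0 e t \<noteq> {}"
proof -
  have "top_pos N X0 e t \<in> (\<lambda>i. maxplus_proc N X0 e t i) ` {1..N}"
    unfolding top_pos_def using assms by (intro Max_in) auto
  thus ?thesis
    by (auto simp: leaders_def)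
qed

lemma leadersD: "j \<in> leaders N X0 e t \<Longrightarrow> maxplus_proc N X0 e t j = top_pos N X0 e t"
  by (simp add: leaders_def)

lemma maxplus_step_ge:
  "j \<in> {1..N} \<Longrightarrow> maxplus_proc N X0 e t j + real_of_int (e i j (Suc t)) \<le> maxplus_proc N X0 e (Suc t) i"
  by auto

lemma maxplus_step_le:
  assumes "N \<ge> 1" "\<And>j. j \<in> {1..N} \<Longrightarrow> maxplus_proc N X0 e t j + real_of_int (e i j (Suc t)) \<le> b"
  shows "maxplus_proc N X0 e (Suc t) i \<le> b"
  using assms by auto

lemma top_pos_le:
  assumes "N \<ge> 1" "\<And>i. i \<in> {1..N} \<Longrightarrow> maxplus_proc N X0 e t i \<le> b"
  shows "top_pos N X0 e t \<le> b"
  using assms by (auto simp: top_pos_def)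

lemma top_pos_step_ge:
  assumes "j \<in> leaders N X0 e t" "i \<in> {1..N}"
  shows "top_pos N X0 e t + real_of_int (e i j (Suc t)) \<le> top_pos N X0 e (Suc t)"
proof -
  have "top_pos N X0 e t + real_of_int (e i j (Suc t)) \<le> maxplus_proc N X0 e (Suc t) i"
    using maxplus_step_ge[OF leaders_mem[OF assms(1)], of X0 e t i] leadersD[OF assms(1)] by simp
  thus ?thesis
    using maxplus_le_top[OF assms(2)] by (rule order.trans)
qed

section \<open>Integer positions and one step of the front\<close>

lemma maxplus_proc_Ints:
  assumes "N \<ge> 1" "i \<in> {1..N}" "\<And>i. X0 i \<in> \<int>"
  shows "maxplus_proc N X0 e t i \<in> \<int>"
  using assms(2)
proof (induction t arbitrary: i)
  case (Suc t)
  have "maxplus_proc N X0 e (Suc t) i \<in> (\<lambda>j. maxplus_proc N X0 e t j + real_of_int (e i j (Suc t))) ` {1..N}"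
    unfolding maxplus_proc.simps using assms by (intro Max_in) auto
  thus ?case
    using Suc.IH by auto
qed (use assms in auto)

text \<open>Integrality turns a strict gap into a gap of at least 1. A nonleader closer than that
  could take over the lead with a loss smaller than 1.\<close>

lemma nonleader_le:
  assumes "N \<ge> 1" "\<And>i. X0 i \<in> \<int>" "j \<in> {1..N}" "j \<notin> leaders N X0 e t"
  shows "maxplus_proc N X0 e t j \<le> top_pos N X0 e t - 1"
proof -
  obtain l where l: "l \<in> leaders N X0 e t"
    using leaders_nonempty[OF assms(1)] by blast
  hence "maxplus_proc N X0 e t l \<in> \<int>" "maxplus_proc N X0 e t j \<in> \<int>"
    using assms leaders_mem[OF l] by (auto intro!: maxplus_proc_Ints)
  then obtain a b where ab: "maxplus_proc N X0 e t l = of_int a" "maxplus_proc N X0 e t j = of_int b"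
    by (auto elim!: Ints_cases)
  moreover have "maxplus_proc N X0 e t j < maxplus_proc N X0 e t l"
    using assms maxplus_le_top[OF assms(3), of X0 e t] leadersD[OF l] by (auto simp: leaders_def)
  ultimately show ?thesis
    using leadersD[OF l] by simp
qed

context
  fixes N :: nat and k :: int and X0 :: "nat \<Rightarrow> real" and e :: "nat \<Rightarrow> nat \<Rightarrow> nat \<Rightarrow> int" and t :: nat
  assumes N: "N \<ge> 1" and X0: "\<And>i. X0 i \<in> \<int>"
    and le: "\<And>i j. i \<in> {1..N} \<Longrightarrow> j \<in> {1..N} \<Longrightarrow> e i j (Suc t) \<le> k"
begin

text \<open>Every way to reach i loses at least 1: from a leader the edge is at most k - 1, and any
  other source is already 1 behind and gains at most k.\<close>

lemma maxplus_nonsuccessor_le: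
  assumes "i \<in> {1..N}" "i \<notin> next_leaders N k X0 e t"
  shows "maxplus_proc N X0 e (Suc t) i \<le> top_pos N X0 e t + k - 1"
proof -
  have "maxplus_proc N X0 e t j + real_of_int (e i j (Suc t)) \<le> top_pos N X0 e t + k - 1" if j: "j \<in> {1..N}" for j
  proof (cases "j \<in> leaders N X0 e t")
    case True
    hence "e i j (Suc t) \<noteq> k"
      using assms by (auto simp: successors_def)
    hence "e i j (Suc t) \<le> k - 1"
      using le[OF assms(1) j] by simp
    hence "real_of_int (e i j (Suc t)) \<le> k - 1"
      by linarith
    then show ?thesis
      using leadersD[OF True] by simp
  next
    case False
    have "maxplus_proc N X0 e t j \<le> top_pos N X0 e t - 1"
      using N X0 j False by (rule nonleader_le)
    moreover have "real_of_int (e i j (Suc t)) \<le> real_of_int k"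
      using le[OF assms(1) j] by simp
    ultimately show ?thesis
      by linarith
  qed
  then show ?thesis
    by (rule maxplus_step_le[OF N])
qed

lemma maxplus_step_le_top:
  assumes "i \<in> {1..N}"
  shows "maxplus_proc N X0 e (Suc t) i \<le> top_pos N X0 e t + k"
  using N maxplus_le_top le assms by (intro maxplus_step_le add_mono) auto

lemma top_pos_step_extinct: "next_leaders N k X0 e t = {} \<Longrightarrow> top_pos N X0 e (Suc t) \<le> top_pos N X0 e t + k - 1"
  using maxplus_nonsuccessor_le N by (intro top_pos_le) auto

lemma top_pos_step_survive:
  assumes "next_leaders N k X0 e t \<noteq> {}"
  shows "top_pos N X0 e (Suc t) = top_pos N X0 e t + k"
proof (rule antisym)
  show "top_pos N X0 e (Suc t) \<le> top_pos N X0 e t + k"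
    using maxplus_step_le_top N by (intro top_pos_le) auto
  obtain i j where "i \<in> {1..N}" "j \<in> leaders N X0 e t" "e i j (Suc t) = k"
    using assms by (auto simp: successors_def)
  thus "top_pos N X0 e t + k \<le> top_pos N X0 e (Suc t)"
    using top_pos_step_ge[of j N X0 e t i] by simp
qed

text \<open>Nonsuccessors land at least 1 below the new front, so as long as no loss occurs the next
  leaders depend on the past only through the present ones.\<close>

lemma leaders_step_survive:
  assumes "next_leaders N k X0 e t \<noteq> {}"
  shows "leaders N X0 e (Suc t) = next_leaders N k X0 e t"
proof (intro set_eqI iffI)
  fix i assume i: "i \<in> leaders N X0 e (Suc t)"
  hence "i \<in> {1..N}" "maxplus_proc N X0 e (Suc t) i = top_pos N X0 e t + k"
    using leadersD[OF i] top_pos_step_survive[OF assms] leaders_mem[OF i] by simp_all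
  thus "i \<in> next_leaders N k X0 e t"
    using maxplus_nonsuccessor_le[of i] by force
next
  fix i assume i: "i \<in> next_leaders N k X0 e t"
  then obtain j where j: "i \<in> {1..N}" "j \<in> leaders N X0 e t" "e i j (Suc t) = k"
    by (auto simp: successors_def)
  hence "top_pos N X0 e t + k \<le> maxplus_proc N X0 e (Suc t) i"
    using maxplus_step_ge[OF leaders_mem[OF j(2)], of X0 e t i] leadersD[OF j(2)] by simp
  moreover have "maxplus_proc N X0 e (Suc t) i \<le> top_pos N X0 e (Suc t)"
    using j by (intro maxplus_le_top)
  ultimately show "i \<in> leaders N X0 e (Suc t)"
    unfolding leaders_def using top_pos_step_survive[OF assms] j(1) by simp
qed

end

section \<open>Dependence on the environment and on the start\<close>

lemma maxplus_proc_cong: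
  assumes "i \<in> {1..N}"
    and "\<And>i j s. i \<in> {1..N} \<Longrightarrow> j \<in> {1..N} \<Longrightarrow> s \<in> {1..t} \<Longrightarrow> e i j s = e' i j s"
  shows "maxplus_proc N X0 e t i = maxplus_proc N X0 e' t i"
  using assms
proof (induction t arbitrary: i)
  case (Suc t)
  have "maxplus_proc N X0 e t j + real_of_int (e i j (Suc t)) = maxplus_proc N X0 e' t j + real_of_int (e' i j (Suc t))"
    if "j \<in> {1..N}" for j
    using Suc.prems that by (intro arg_cong2[of _ _ _ _ "(+)"] Suc.IH) auto
  thus ?case
    by (auto intro!: arg_cong[of _ _ Max])
qed auto

text \<open>Exhibits the leaders at time t as a function of finitely many variables with times 1 to
  t, which is what makes them independent of the next slice.\<close>

lemma leaders_cong:
  assumes "\<And>i j s. i \<in> {1..N} \<Longrightarrow> j \<in> {1..N} \<Longrightarrow> s \<in> {1..t} \<Longrightarrow> e i j s = e' i j s"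
  shows "leaders N X0 e t = leaders N X0 e' t"
proof -
  have eq: "maxplus_proc N X0 e t i = maxplus_proc N X0 e' t i" if "i \<in> {1..N}" for i
    using that assms by (rule maxplus_proc_cong)
  have "top_pos N X0 e t = top_pos N X0 e' t"
    unfolding top_pos_def using eq by (auto intro!: arg_cong[of _ _ Max])
  thus ?thesis
    using eq by (auto simp: leaders_def)
qed

text \<open>A max-plus linear map is monotone and commutes with adding a constant to all positions;
  the constant travels unchanged through the recursion.\<close>

lemma maxplus_proc_mono_shift:
  assumes N: "N \<ge> 1" and i: "i \<in> {1..N}" and X: "\<And>j. j \<in> {1..N} \<Longrightarrow> X0 j \<le> Y0 j + c"
  shows "maxplus_proc N X0 e t i \<le> maxplus_proc N Y0 e t i + c"
  using i
proof (induction t arbitrary: i)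
  case (Suc t)
  show ?case
  proof (rule maxplus_step_le[OF N])
    fix j assume j: "j \<in> {1..N}"
    show "maxplus_proc N X0 e t j + real_of_int (e i j (Suc t)) \<le> maxplus_proc N Y0 e (Suc t) i + c"
      using maxplus_step_ge[OF j, of Y0 e t i] Suc.IH[OF j] by linarith
  qed
qed (use X in auto)

lemma top_pos_mono_shift:
  assumes N: "N \<ge> 1" and X: "\<And>j. j \<in> {1..N} \<Longrightarrow> X0 j \<le> Y0 j + c"
  shows "top_pos N X0 e t \<le> top_pos N Y0 e t + c"
proof (rule top_pos_le[OF N])
  fix i assume i: "i \<in> {1..N}"
  show "maxplus_proc N X0 e t i \<le> top_pos N Y0 e t + c"
    using maxplus_proc_mono_shift[OF N i, of X0 Y0 c e t] X maxplus_le_top[OF i, of Y0 e t] by force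
qed

text \<open>By the shift estimate two starts stay within a constant of each other, and dividing by t
  removes it. This licenses the integral start 0 in place of the arbitrary real one.\<close>

lemma top_pos_limit_zero_start:
  assumes N: "N \<ge> 1" and lim: "(\<lambda>t. top_pos N X0 e t / real t) \<longlonglongrightarrow> v"
  shows "(\<lambda>t. top_pos N (\<lambda>_. 0) e t / real t) \<longlonglongrightarrow> v"
proof -
  define c where "c = Max ((\<lambda>j. \<bar>X0 j\<bar>) ` {1..N})"
  have c: "\<bar>X0 j\<bar> \<le> c" if "j \<in> {1..N}" for j
    using that by (auto simp: c_def)
  have 1: "top_pos N (\<lambda>_. 0) e t \<le> top_pos N X0 e t + c" for t
    using c by (intro top_pos_mono_shift[OF N]) fastforce
  have 2: "top_pos N X0 e t \<le> top_pos N (\<lambda>_. 0) e t + c" for t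
    using c by (intro top_pos_mono_shift[OF N]) fastforce
  have "(\<lambda>t. top_pos N (\<lambda>_. 0) e t / real t - top_pos N X0 e t / real t) \<longlonglongrightarrow> 0"
  proof (rule Lim_null_comparison)
    show "\<forall>\<^sub>F t in sequentially. norm (top_pos N (\<lambda>_. 0) e t / real t - top_pos N X0 e t / real t) \<le> c / real t"
    proof (intro always_eventually allI)
      fix t
      have "\<bar>top_pos N (\<lambda>_. 0) e t - top_pos N X0 e t\<bar> \<le> c"
        using 1[of t] 2[of t] by (simp add: abs_le_iff)
      thus "norm (top_pos N (\<lambda>_. 0) e t / real t - top_pos N X0 e t / real t) \<le> c / real t"
        by (simp add: divide_right_mono flip: diff_divide_distrib)
    qed
    show "(\<lambda>t. c / real t) \<longlonglongrightarrow> 0"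
      by (rule lim_const_over_n)
  qed
  from tendsto_add[OF this lim] show ?thesis
    by simp
qed

section \<open>Measurability, and passage from expectations to almost sure limits\<close>

lemma measurable_maxplus_proc:
  assumes N: "N \<ge> 1" and i: "i \<in> {1..N}"
    and e: "\<And>i j s. i \<in> {1..N} \<Longrightarrow> j \<in> {1..N} \<Longrightarrow> s \<in> {1..t} \<Longrightarrow> (\<lambda>x. e x i j s) \<in> measurable P (count_space UNIV)"
  shows "(\<lambda>x. maxplus_proc N X0 (e x) t i) \<in> borel_measurable P"
  using i e
proof (induction t arbitrary: i)
  case (Suc t)
  have "(\<lambda>x. real_of_int (e x i j (Suc t))) \<in> borel_measurable P" if "j \<in> {1..N}" for j
    using measurable_compose[OF Suc.prems(2)[of i j "Suc t"], of real_of_int borel] Suc.prems(1) that by simp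
  thus ?case
    unfolding maxplus_proc.simps using Suc by (intro borel_measurable_Max borel_measurable_add) auto
qed auto

lemma measurable_top_pos:
  assumes N: "N \<ge> 1"
    and e: "\<And>i j s. i \<in> {1..N} \<Longrightarrow> j \<in> {1..N} \<Longrightarrow> s \<in> {1..t} \<Longrightarrow> (\<lambda>x. e x i j s) \<in> measurable P (count_space UNIV)"
  shows "(\<lambda>x. top_pos N X0 (e x) t) \<in> borel_measurable P"
  unfolding top_pos_def using measurable_maxplus_proc[OF N _ e] by (intro borel_measurable_Max) auto

lemma sets_leaders:
  assumes N: "N \<ge> 1"
    and e: "\<And>i j s. i \<in> {1..N} \<Longrightarrow> j \<in> {1..N} \<Longrightarrow> s \<in> {1..t} \<Longrightarrow> (\<lambda>x. e x i j s) \<in> measurable P (count_space UNIV)"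
  shows "{x \<in> space P. leaders N X0 (e x) t = A} \<in> sets P"
proof (cases "A \<subseteq> {1..N}")
  case True
  have [measurable]: "(\<lambda>x. top_pos N X0 (e x) t) \<in> borel_measurable P"
    using N e by (rule measurable_top_pos)
  have [measurable]: "(\<lambda>x. maxplus_proc N X0 (e x) t i) \<in> borel_measurable P" if "i \<in> {1..N}" for i
    using N that e by (rule measurable_maxplus_proc)
  have "{x \<in> space P. \<forall>i\<in>{1..N}. (i \<in> A \<longleftrightarrow> maxplus_proc N X0 (e x) t i = top_pos N X0 (e x) t)} \<in> sets P"
    by measurable
  also have "{x \<in> space P. \<forall>i\<in>{1..N}. (i \<in> A \<longleftrightarrow> maxplus_proc N X0 (e x) t i = top_pos N X0 (e x) t)} =
      {x \<in> space P. leaders N X0 (e x) t = A}"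
    using True by (auto simp: leaders_def)
  finally show ?thesis .
next
  case False
  hence "{x \<in> space P. leaders N X0 (e x) t = A} = {}"
    using leaders_subset by blast
  thus ?thesis by (simp only: sets.empty_sets)
qed

lemma successors_subset: "successors N k A x \<subseteq> {1..N}"
  by (auto simp: successors_def)

lemma successors_eq_iff:
  "B \<subseteq> {1..N} \<Longrightarrow> successors N k A x = B \<longleftrightarrow> (\<forall>i\<in>{1..N}. i \<in> B \<longleftrightarrow> (\<exists>j\<in>A. x i j = k))"
  unfolding successors_def by blast

lemma successors_cong:
  assumes "\<And>i j. i \<in> {1..N} \<Longrightarrow> j \<in> A \<Longrightarrow> x i j = y i j"
  shows "successors N k A x = successors N k A y"
  using assms by (auto simp: successors_def)

lemma measurable_successors:
  assumes e: "\<And>i j. i \<in> {1..N} \<Longrightarrow> j \<in> A \<Longrightarrow> (\<lambda>x. e x i j) \<in> measurable P (count_space UNIV)" and A: "finite A"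
  shows "(\<lambda>x. successors N k A (e x)) \<in> measurable P (count_space (Pow {1..N}))"
  unfolding measurable_count_space_eq_countable[OF countable_finite[OF finite_Pow_iff[THEN iffD2, OF finite_atLeastAtMost]]]
proof (intro conjI ballI)
  fix B assume B: "B \<in> Pow {1..N}"
  note [measurable] = e
  have [measurable]: "(\<lambda>x. e x i j = k) \<in> measurable P (count_space UNIV)" if "i \<in> {1..N}" "j \<in> A" for i j
    using measurable_compose[OF e[OF that], of "\<lambda>v. v = k" "count_space UNIV"] by simp
  have "{x \<in> space P. \<forall>i\<in>{1..N}. (i \<in> B \<longleftrightarrow> (\<exists>j\<in>A. e x i j = k))} \<in> sets P"
    using A by measurable
  also have "{x \<in> space P. \<forall>i\<in>{1..N}. (i \<in> B \<longleftrightarrow> (\<exists>j\<in>A. e x i j = k))} =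
      (\<lambda>x. successors N k A (e x)) -` {B} \<inter> space P"
    using successors_eq_iff[of B N k A] B by auto
  finally show "(\<lambda>x. successors N k A (e x)) -` {B} \<inter> space P \<in> sets P" .
qed (use successors_subset in auto)

text \<open>Fatou's lemma for positive parts, since \<open>ennreal\<close> truncates at 0. The bound
  c is nonnegative, so a bound on the positive part of l is a bound on l.\<close>

lemma (in prob_space) limit_le_of_nn_integral_le:
  fixes u :: "nat \<Rightarrow> 'a \<Rightarrow> real"
  assumes u: "\<And>n. u n \<in> borel_measurable M" and lim: "AE \<omega> in M. (\<lambda>n. u n \<omega>) \<longlonglongrightarrow> l"
    and le: "\<forall>\<^sub>F n in sequentially. (\<integral>\<^sup>+\<omega>. ennreal (u n \<omega>) \<partial>M) \<le> ennreal (b n)"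
    and b: "b \<longlonglongrightarrow> c" and c: "0 \<le> c"
  shows "l \<le> c"
proof -
  have "ennreal l = (\<integral>\<^sup>+\<omega>. ennreal l \<partial>M)"
    by (simp add: emeasure_space_1)
  also have "\<dots> = (\<integral>\<^sup>+\<omega>. liminf (\<lambda>n. ennreal (u n \<omega>)) \<partial>M)"
  proof (rule nn_integral_cong_AE, use lim in eventually_elim)
    fix \<omega> assume "(\<lambda>n. u n \<omega>) \<longlonglongrightarrow> l"
    hence "(\<lambda>n. ennreal (u n \<omega>)) \<longlonglongrightarrow> ennreal l"
      by (rule tendsto_ennrealI)
    thus "ennreal l = liminf (\<lambda>n. ennreal (u n \<omega>))"
      by (simp add: lim_imp_Liminf)
  qed
  also have "\<dots> \<le> liminf (\<lambda>n. \<integral>\<^sup>+\<omega>. ennreal (u n \<omega>) \<partial>M)"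
    using u by (intro nn_integral_liminf) measurable
  also have "\<dots> \<le> liminf (\<lambda>n. ennreal (b n))"
    using le by (rule Liminf_mono)
  also have "\<dots> = ennreal c"
    using b by (intro lim_imp_Liminf tendsto_ennrealI) auto
  finally show ?thesis
    using c by (simp add: ennreal_le_iff)
qed

text \<open>Survives truncation: b may be negative, and then its positive part 0 still dominates
  it.\<close>

lemma ennreal_le_add:
  assumes "a \<le> b + c" "0 \<le> c"
  shows "ennreal a \<le> ennreal b + ennreal c"
proof -
  have "ennreal a \<le> ennreal (max b 0 + c)"
    using assms by (intro ennreal_leI) auto
  also have "\<dots> = ennreal b + ennreal c"
    using assms by (simp add: ennreal_plus max_def ennreal_neg)
  finally show ?thesis .
qed

section \<open>The random environment\<close>

text \<open>For fixed N the law of the entries enters only through k and three numbers: q for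
  missing k, r for missing both k and k - 1, and m as a bound on the mean deficit.\<close>

locale maxplus_model = prob_space M
  for M :: "'a measure" +
  fixes N :: nat and k :: int and xi :: "nat \<Rightarrow> nat \<Rightarrow> nat \<Rightarrow> 'a \<Rightarrow> int" and q r m :: real
  assumes N: "N \<ge> 1"
    and rv: "\<And>i j s. xi i j s \<in> measurable M (count_space UNIV)"
    and indep: "indep_vars (\<lambda>_. count_space UNIV) (\<lambda>(i, j, s). xi i j s) ({1..N} \<times> {1..N} \<times> {1..})"
    and le_k: "\<And>i j s. i \<in> {1..N} \<Longrightarrow> j \<in> {1..N} \<Longrightarrow> s \<ge> 1 \<Longrightarrow> AE \<omega> in M. xi i j s \<omega> \<le> k"
    and prob_ne_k: "\<And>i j s. i \<in> {1..N} \<Longrightarrow> j \<in> {1..N} \<Longrightarrow> s \<ge> 1 \<Longrightarrow>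
          prob {\<omega> \<in> space M. xi i j s \<omega> \<noteq> k} = q"
    and prob_low: "\<And>i j s. i \<in> {1..N} \<Longrightarrow> j \<in> {1..N} \<Longrightarrow> s \<ge> 1 \<Longrightarrow>
          prob {\<omega> \<in> space M. xi i j s \<omega> \<notin> {k, k - 1}} = r"
    and mean: "\<And>i j s. i \<in> {1..N} \<Longrightarrow> j \<in> {1..N} \<Longrightarrow> s \<ge> 1 \<Longrightarrow>
          (\<integral>\<^sup>+\<omega>. ennreal (real_of_int (k - xi i j s \<omega>)) \<partial>M) \<le> ennreal m"
    and m_nonneg: "0 \<le> m"
begin

definition env :: "'a \<Rightarrow> nat \<Rightarrow> nat \<Rightarrow> nat \<Rightarrow> int" where
  "env \<omega> i j s = xi i j s \<omega>"

definition front :: "nat \<Rightarrow> 'a \<Rightarrow> nat set" where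
  "front t \<omega> = leaders N (\<lambda>_. 0) (env \<omega>) t"

text \<open>Indexed by the time before the step: \<open>slice t\<close> holds the edges of time
  \<open>Suc t\<close>, which lead from time t to time t + 1.\<close>

definition slice :: "nat \<Rightarrow> (nat \<times> nat \<times> nat) set" where
  "slice t = {1..N} \<times> {1..N} \<times> {Suc t}"

definition draw :: "nat \<Rightarrow> 'a \<Rightarrow> nat \<times> nat \<times> nat \<Rightarrow> int" where
  "draw t \<omega> = restrict (\<lambda>(i, j, s). xi i j s \<omega>) (slice t)"

lemma q_bounds: "0 \<le> q" "q \<le> 1"
  using prob_ne_k[of 1 1 1] N by auto

lemma r_nonneg: "0 \<le> r"
  using prob_low[of 1 1 1] N by (metis measure_nonneg atLeastAtMost_iff le_refl)

lemma sets_front [measurable]: "{\<omega> \<in> space M. front t \<omega> = A} \<in> sets M"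
  unfolding front_def using N rv by (intro sets_leaders) (auto simp: env_def)

lemma front_subset: "front t \<omega> \<subseteq> {1..N}"
  unfolding front_def by (rule leaders_subset)

lemma front_nonempty: "front t \<omega> \<noteq> {}"
  unfolding front_def using N by (rule leaders_nonempty)

lemma card_front: "card (front t \<omega>) \<in> {1..N}"
  using front_subset[of t \<omega>] front_nonempty[of t \<omega>] card_mono[OF _ front_subset[of t \<omega>]]
  by (auto simp: Suc_le_eq card_gt_0_iff intro: finite_subset)

lemma measurable_draw [measurable]: "draw t \<in> measurable M (PiM (slice t) (\<lambda>_. count_space UNIV))"
  unfolding draw_def using rv by (intro measurable_restrict) auto

section \<open>The Markov property of the set of leaders\<close>

text \<open>The leaders at time t use the variables of times 1 to t and the draw those of time t +
  1, two disjoint blocks of an independent family. As the set of leaders has finitely many values,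
  conditioning reduces to multiplying by indicators.\<close>

lemma front_draw_indep:
  assumes [measurable]: "F \<in> borel_measurable (PiM (slice t) (\<lambda>_. count_space UNIV))"
  shows "(\<integral>\<^sup>+\<omega>. indicator {\<omega>. front t \<omega> = A} \<omega> * (F (draw t \<omega>) :: ennreal) \<partial>M)
    = emeasure M {\<omega> \<in> space M. front t \<omega> = A} * (\<integral>\<^sup>+\<omega>. F (draw t \<omega>) \<partial>M)"
proof -
  define past where "past = {1..N} \<times> {1..N} \<times> {1..t}"
  define X where "X = (\<lambda>(i, j, s). xi i j s)"
  define Y :: "(nat \<times> nat \<times> nat \<Rightarrow> int) \<Rightarrow> ennreal" where
    "Y = indicator {x. leaders N (\<lambda>_. 0) (\<lambda>i j s. x (i, j, s)) t = A}"
  have ind: "indep_var (PiM past (\<lambda>_. count_space UNIV)) (\<lambda>\<omega>. restrict (\<lambda>p. X p \<omega>) past)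
      (PiM (slice t) (\<lambda>_. count_space UNIV)) (\<lambda>\<omega>. restrict (\<lambda>p. X p \<omega>) (slice t))"
    using indep unfolding X_def by (rule indep_var_restrict) (auto simp: past_def slice_def)
  have [measurable]: "Y \<in> borel_measurable (PiM past (\<lambda>_. count_space UNIV))"
    unfolding Y_def
  proof (rule borel_measurable_indicator')
    show "{x \<in> space (PiM past (\<lambda>_. count_space UNIV)). x \<in> {x. leaders N (\<lambda>_. 0) (\<lambda>i j s. x (i, j, s)) t = A}}
        \<in> sets (PiM past (\<lambda>_. count_space UNIV))"
      unfolding mem_Collect_eq using N
      by (intro sets_leaders measurable_component_singleton) (auto simp: past_def)
  qed
  have "indep_var borel (Y \<circ> (\<lambda>\<omega>. restrict (\<lambda>p. X p \<omega>) past)) borel (F \<circ> (\<lambda>\<omega>. restrict (\<lambda>p. X p \<omega>) (slice t)))"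
    by (intro indep_var_compose[OF ind]) measurable
  hence "indep_vars (\<lambda>_. borel) (case_bool (Y \<circ> (\<lambda>\<omega>. restrict (\<lambda>p. X p \<omega>) past))
      (F \<circ> (\<lambda>\<omega>. restrict (\<lambda>p. X p \<omega>) (slice t)))) UNIV"
    unfolding indep_var_def by (rule iffD1[OF indep_vars_cong, rotated -1]) (auto split: bool.split)
  from indep_vars_nn_integral[OF _ this]
  have "(\<integral>\<^sup>+\<omega>. Y (restrict (\<lambda>p. X p \<omega>) past) * F (restrict (\<lambda>p. X p \<omega>) (slice t)) \<partial>M)
     = (\<integral>\<^sup>+\<omega>. Y (restrict (\<lambda>p. X p \<omega>) past) \<partial>M) * (\<integral>\<^sup>+\<omega>. F (restrict (\<lambda>p. X p \<omega>) (slice t)) \<partial>M)"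
    by (simp add: UNIV_bool mult.commute comp_def)
  moreover have "restrict (\<lambda>p. X p \<omega>) (slice t) = draw t \<omega>" for \<omega>
    by (auto simp: draw_def X_def fun_eq_iff)
  moreover have "Y (restrict (\<lambda>p. X p \<omega>) past) = indicator {\<omega>. front t \<omega> = A} \<omega>" for \<omega>
  proof -
    \<comment> \<open>Outside \<open>past\<close> the restricted function takes an arbitrary value,
      which the leaders at time t do not see.\<close>
    have "leaders N (\<lambda>_. 0) (\<lambda>i j s. restrict (\<lambda>p. X p \<omega>) past (i, j, s)) t = front t \<omega>"
      unfolding front_def by (rule leaders_cong) (auto simp: past_def X_def env_def)
    thus ?thesis
      by (simp add: Y_def indicator_def)
  qed
  moreover have "(\<integral>\<^sup>+\<omega>. indicator {\<omega>. front t \<omega> = A} \<omega> \<partial>M) = emeasure M {\<omega> \<in> space M. front t \<omega> = A}"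
  proof -
    have "(\<integral>\<^sup>+\<omega>. indicator {\<omega>. front t \<omega> = A} \<omega> \<partial>M) = (\<integral>\<^sup>+\<omega>. indicator {\<omega> \<in> space M. front t \<omega> = A} \<omega> \<partial>M)"
      by (intro nn_integral_cong) (auto simp: indicator_def)
    thus ?thesis by simp
  qed
  ultimately show ?thesis
    by simp
qed

lemma measurable_indicator_front [measurable]: "indicator {\<omega>. front t \<omega> = A} \<in> borel_measurable M"
  by (rule borel_measurable_indicator') simp

lemma front_draw_sum:
  "F (front t \<omega>) (draw t \<omega>) = (\<Sum>A\<in>Pow {1..N}. indicator {\<omega>. front t \<omega> = A} \<omega> * (F A (draw t \<omega>) :: ennreal))"
proof -
  have "(\<Sum>A\<in>Pow {1..N}. indicator {\<omega>. front t \<omega> = A} \<omega> * F A (draw t \<omega>)) =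
    (\<Sum>A\<in>Pow {1..N}. if A = front t \<omega> then F (front t \<omega>) (draw t \<omega>) else 0)"
    by (intro sum.cong) (auto simp: indicator_def)
  thus ?thesis
    using front_subset[of t \<omega>] by simp
qed

context
  fixes t :: nat and F :: "nat set \<Rightarrow> (nat \<times> nat \<times> nat \<Rightarrow> int) \<Rightarrow> ennreal"
  assumes F: "\<And>A. A \<subseteq> {1..N} \<Longrightarrow> F A \<in> borel_measurable (PiM (slice t) (\<lambda>_. count_space UNIV))"
begin

lemma measurable_indicator_front_draw:
  assumes "A \<in> Pow {1..N}"
  shows "(\<lambda>\<omega>. indicator {\<omega>. front t \<omega> = A} \<omega> * F A (draw t \<omega>)) \<in> borel_measurable M"
proof -
  have [measurable]: "(\<lambda>\<omega>. F A (draw t \<omega>)) \<in> borel_measurable M"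
    using assms by (intro measurable_compose[OF measurable_draw F]) auto
  show ?thesis by measurable
qed

lemma measurable_front_draw: "(\<lambda>\<omega>. F (front t \<omega>) (draw t \<omega>)) \<in> borel_measurable M"
  unfolding front_draw_sum by (intro borel_measurable_sum measurable_indicator_front_draw)

lemma markov_step:
  "(\<integral>\<^sup>+\<omega>. F (front t \<omega>) (draw t \<omega>) \<partial>M)
    = (\<Sum>A\<in>Pow {1..N}. emeasure M {\<omega> \<in> space M. front t \<omega> = A} * (\<integral>\<^sup>+\<omega>. F A (draw t \<omega>) \<partial>M))"
proof -
  have "(\<integral>\<^sup>+\<omega>. F (front t \<omega>) (draw t \<omega>) \<partial>M) =
      (\<Sum>A\<in>Pow {1..N}. \<integral>\<^sup>+\<omega>. indicator {\<omega>. front t \<omega> = A} \<omega> * F A (draw t \<omega>) \<partial>M)"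
    unfolding front_draw_sum by (intro nn_integral_sum measurable_indicator_front_draw)
  also have "\<dots> = (\<Sum>A\<in>Pow {1..N}. emeasure M {\<omega> \<in> space M. front t \<omega> = A} * (\<integral>\<^sup>+\<omega>. F A (draw t \<omega>) \<partial>M))"
    by (intro sum.cong refl front_draw_indep F) auto
  finally show ?thesis .
qed

end

text \<open>The form in which the Markov property is applied: a comparison for each fixed nonempty
  set suffices, because the set of leaders is never empty.\<close>

lemma markov_step_mono:
  assumes F: "\<And>A. A \<subseteq> {1..N} \<Longrightarrow> F A \<in> borel_measurable (PiM (slice t) (\<lambda>_. count_space UNIV))"
    and G: "\<And>A. A \<subseteq> {1..N} \<Longrightarrow> G A \<in> borel_measurable (PiM (slice t) (\<lambda>_. count_space UNIV))"
    and le: "\<And>A. A \<subseteq> {1..N} \<Longrightarrow> A \<noteq> {} \<Longrightarrow> (\<integral>\<^sup>+\<omega>. F A (draw t \<omega>) \<partial>M) \<le> (\<integral>\<^sup>+\<omega>. (G A (draw t \<omega>) :: ennreal) \<partial>M)"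
  shows "(\<integral>\<^sup>+\<omega>. F (front t \<omega>) (draw t \<omega>) \<partial>M) \<le> (\<integral>\<^sup>+\<omega>. G (front t \<omega>) (draw t \<omega>) \<partial>M)"
proof -
  have "emeasure M {\<omega> \<in> space M. front t \<omega> = A} * (\<integral>\<^sup>+\<omega>. F A (draw t \<omega>) \<partial>M)
     \<le> emeasure M {\<omega> \<in> space M. front t \<omega> = A} * (\<integral>\<^sup>+\<omega>. G A (draw t \<omega>) \<partial>M)" if "A \<in> Pow {1..N}" for A
  proof (cases "A = {}")
    case True
    thus ?thesis using front_nonempty by simp
  next
    case False
    thus ?thesis using le that by (intro mult_left_mono) auto
  qed
  moreover have "(\<integral>\<^sup>+\<omega>. F (front t \<omega>) (draw t \<omega>) \<partial>M)
    = (\<Sum>A\<in>Pow {1..N}. emeasure M {\<omega> \<in> space M. front t \<omega> = A} * (\<integral>\<^sup>+\<omega>. F A (draw t \<omega>) \<partial>M))"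
    by (rule markov_step) (rule F)
  moreover have "(\<integral>\<^sup>+\<omega>. G (front t \<omega>) (draw t \<omega>) \<partial>M)
    = (\<Sum>A\<in>Pow {1..N}. emeasure M {\<omega> \<in> space M. front t \<omega> = A} * (\<integral>\<^sup>+\<omega>. G A (draw t \<omega>) \<partial>M))"
    by (rule markov_step) (rule G)
  ultimately show ?thesis
    by (simp only:) (rule sum_mono)
qed

section \<open>The law of the successors\<close>

lemma prob_row_extinct:
  assumes "i \<in> {1..N}" "A \<subseteq> {1..N}" "s \<ge> 1"
  shows "prob {\<omega> \<in> space M. \<forall>j\<in>A. xi i j s \<omega> \<noteq> k} = q ^ card A"
proof -
  have fin: "finite A" using assms finite_subset by blast
  define I where "I = {i} \<times> A \<times> {s}"
  have I: "I \<subseteq> {1..N} \<times> {1..N} \<times> {1..}" "finite I"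
    using assms fin by (auto simp: I_def)
  define Y :: "int \<Rightarrow> ennreal" where "Y = indicator {v. v \<noteq> k}"
  have "indep_vars (\<lambda>_. borel) (\<lambda>p \<omega>. Y ((\<lambda>(i, j, s). xi i j s) p \<omega>)) I"
    by (rule indep_vars_compose2[OF indep_vars_subset[OF indep I(1)]]) simp
  from indep_vars_nn_integral[OF I(2) this]
  have "(\<integral>\<^sup>+\<omega>. (\<Prod>p\<in>I. Y ((\<lambda>(i, j, s). xi i j s) p \<omega>)) \<partial>M) = (\<Prod>p\<in>I. \<integral>\<^sup>+\<omega>. Y ((\<lambda>(i, j, s). xi i j s) p \<omega>) \<partial>M)"
    by simp
  also have "\<dots> = (\<Prod>p\<in>I. ennreal q)"
  proof (intro prod.cong refl)
    fix p assume "p \<in> I"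
    then obtain j where j: "p = (i, j, s)" "j \<in> {1..N}" using assms by (auto simp: I_def)
    have "(\<integral>\<^sup>+\<omega>. Y (xi i j s \<omega>) \<partial>M) = (\<integral>\<^sup>+\<omega>. indicator {\<omega> \<in> space M. xi i j s \<omega> \<noteq> k} \<omega> \<partial>M)"
      by (intro nn_integral_cong) (auto simp: Y_def indicator_def)
    also have "\<dots> = emeasure M {\<omega> \<in> space M. xi i j s \<omega> \<noteq> k}"
      by (intro nn_integral_indicator measurable_sets_Collect[OF rv, of "\<lambda>v. v \<noteq> k"]) simp
    also have "\<dots> = ennreal q"
      using prob_ne_k[of i j s] assms j by (simp add: emeasure_eq_measure)
    finally show "(\<integral>\<^sup>+\<omega>. Y ((\<lambda>(i, j, s). xi i j s) p \<omega>) \<partial>M) = ennreal q"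
      using j by simp
  qed
  also have "\<dots> = ennreal (q ^ card A)"
    using q_bounds by (simp add: I_def card_cartesian_product ennreal_power)
  also have "(\<integral>\<^sup>+\<omega>. (\<Prod>p\<in>I. Y ((\<lambda>(i, j, s). xi i j s) p \<omega>)) \<partial>M) =
      (\<integral>\<^sup>+\<omega>. indicator {\<omega> \<in> space M. \<forall>j\<in>A. xi i j s \<omega> \<noteq> k} \<omega> \<partial>M)"
    using fin by (intro nn_integral_cong) (auto simp: I_def Y_def indicator_def prod_zero_iff intro!: prod.neutral)
  also have "\<dots> = emeasure M {\<omega> \<in> space M. \<forall>j\<in>A. xi i j s \<omega> \<noteq> k}"
  proof (intro nn_integral_indicator sets.sets_Collect_finite_All fin)
    show "{\<omega> \<in> space M. xi i j s \<omega> \<noteq> k} \<in> sets M" for j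
      by (rule measurable_sets_Collect[OF rv, of "\<lambda>v. v \<noteq> k"]) simp
  qed
  finally show ?thesis
    using q_bounds by (simp add: emeasure_eq_measure)
qed

lemma sets_row [measurable]: "finite A \<Longrightarrow> {\<omega> \<in> space M. \<forall>j\<in>A. xi i j s \<omega> \<noteq> k} \<in> sets M"
proof (rule sets.sets_Collect_finite_All)
  show "{\<omega> \<in> space M. xi i j s \<omega> \<noteq> k} \<in> sets M" for j
    by (rule measurable_sets_Collect[OF rv, of "\<lambda>v. v \<noteq> k"]) simp
qed

lemma measurable_successors_xi:
  "finite A \<Longrightarrow> (\<lambda>\<omega>. successors N k A (\<lambda>i j. xi i j s \<omega>)) \<in> measurable M (count_space (Pow {1..N}))"
  using rv by (intro measurable_successors) auto

lemma sets_successors: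
  assumes "finite A" "B \<subseteq> {1..N}"
  shows "{\<omega> \<in> space M. successors N k A (\<lambda>i j. xi i j s \<omega>) = B} \<in> sets M"
proof -
  have "(\<lambda>\<omega>. successors N k A (\<lambda>i j. xi i j s \<omega>)) -` {B} \<inter> space M \<in> sets M"
    using assms by (intro measurable_sets[OF measurable_successors_xi]) auto
  thus ?thesis
    by (simp add: vimage_def Int_def conj_commute)
qed

text \<open>Particle i succeeds iff its row shows k in some column of A, an event of probability
  \<open>1 - q ^ card A\<close>. Rows use disjoint blocks of variables, so these events are
  independent, and prescribing the whole set B makes the probability a plain product.\<close>

lemma emeasure_successors_eq:
  assumes A: "A \<subseteq> {1..N}" and s: "s \<ge> 1" and B: "B \<subseteq> {1..N}"
  shows "emeasure M {\<omega> \<in> space M. successors N k A (\<lambda>i j. xi i j s \<omega>) = B}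
    = ennreal ((1 - q ^ card A) ^ card B * (q ^ card A) ^ (N - card B))"
proof -
  note rv [measurable]
  have fin: "finite A" "finite B" using A B finite_subset by blast+
  define Q where "Q = q ^ card A"
  have Q: "0 \<le> Q" "Q \<le> 1"
    using q_bounds by (auto simp: Q_def power_le_one)
  define K where "K i = {i} \<times> A \<times> {s}" for i :: nat
  define X where "X = (\<lambda>(i, j, s). xi i j s)"
  define Y :: "nat \<Rightarrow> (nat \<times> nat \<times> nat \<Rightarrow> int) \<Rightarrow> ennreal" where
    "Y i = indicator {x. i \<in> B \<longleftrightarrow> \<not> (\<forall>j\<in>A. x (i, j, s) \<noteq> k)}" for i
  have ind: "indep_vars (\<lambda>i. PiM (K i) (\<lambda>_. count_space UNIV)) (\<lambda>i \<omega>. restrict (\<lambda>p. X p \<omega>) (K i)) {1..N}"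
    using indep unfolding X_def
    by (rule indep_vars_restrict) (use A s in \<open>auto simp: K_def disjoint_family_on_def\<close>)
  have Ym: "Y i \<in> borel_measurable (PiM (K i) (\<lambda>_. count_space UNIV))" for i
    unfolding Y_def
  proof (rule borel_measurable_indicator')
    let ?P = "PiM (K i) (\<lambda>_. count_space UNIV) :: (nat \<times> nat \<times> nat \<Rightarrow> int) measure"
    have "{x \<in> space ?P. x (i, j, s) \<noteq> k} \<in> sets ?P" if "j \<in> A" for j
      by (rule measurable_sets_Collect[OF measurable_component_singleton, of "(i, j, s)" "K i" _ "\<lambda>v. v \<noteq> k"])
         (use that in \<open>auto simp: K_def\<close>)
    hence [measurable]: "{x \<in> space ?P. \<forall>j\<in>A. x (i, j, s) \<noteq> k} \<in> sets ?P"
      using fin by (intro sets.sets_Collect_finite_All) auto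
    show "{x \<in> space ?P. x \<in> {x. i \<in> B \<longleftrightarrow> \<not> (\<forall>j\<in>A. x (i, j, s) \<noteq> k)}} \<in> sets ?P"
      unfolding mem_Collect_eq by measurable
  qed
  have Yr: "Y i (restrict (\<lambda>p. X p \<omega>) (K i)) = indicator {\<omega>. i \<in> B \<longleftrightarrow> \<not> (\<forall>j\<in>A. xi i j s \<omega> \<noteq> k)} \<omega>" for i \<omega>
    by (simp add: Y_def K_def X_def indicator_def)
  have "indep_vars (\<lambda>_. borel) (\<lambda>i \<omega>. Y i (restrict (\<lambda>p. X p \<omega>) (K i))) {1..N}"
    by (rule indep_vars_compose2[OF ind Ym])
  from indep_vars_nn_integral[OF _ this]
  have "(\<integral>\<^sup>+\<omega>. (\<Prod>i\<in>{1..N}. indicator {\<omega>. i \<in> B \<longleftrightarrow> \<not> (\<forall>j\<in>A. xi i j s \<omega> \<noteq> k)} \<omega>) \<partial>M) =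
      (\<Prod>i\<in>{1..N}. \<integral>\<^sup>+\<omega>. (indicator {\<omega>. i \<in> B \<longleftrightarrow> \<not> (\<forall>j\<in>A. xi i j s \<omega> \<noteq> k)} \<omega> :: ennreal) \<partial>M)"
    by (simp only: Yr finite_atLeastAtMost zero_le)
  also have "\<dots> = (\<Prod>i\<in>{1..N}. if i \<in> B then ennreal (1 - Q) else ennreal Q)"
  proof (intro prod.cong refl)
    fix i assume i: "i \<in> {1..N}"
    note row = prob_row_extinct[OF i A s]
    have "(\<integral>\<^sup>+\<omega>. (indicator {\<omega>. i \<in> B \<longleftrightarrow> \<not> (\<forall>j\<in>A. xi i j s \<omega> \<noteq> k)} \<omega> :: ennreal) \<partial>M) =
      (\<integral>\<^sup>+\<omega>. indicator {\<omega> \<in> space M. i \<in> B \<longleftrightarrow> \<not> (\<forall>j\<in>A. xi i j s \<omega> \<noteq> k)} \<omega> \<partial>M)"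
      by (intro nn_integral_cong) (auto simp: indicator_def)
    also have "\<dots> = emeasure M {\<omega> \<in> space M. i \<in> B \<longleftrightarrow> \<not> (\<forall>j\<in>A. xi i j s \<omega> \<noteq> k)}"
      using fin by (intro nn_integral_indicator) measurable
    also have "\<dots> = (if i \<in> B then ennreal (1 - Q) else ennreal Q)"
    proof (cases "i \<in> B")
      case True
      have "prob {\<omega> \<in> space M. \<not> (\<forall>j\<in>A. xi i j s \<omega> \<noteq> k)} = 1 - Q"
        using prob_neg[of "\<lambda>\<omega>. \<forall>j\<in>A. xi i j s \<omega> \<noteq> k"] sets_row[OF fin(1), of i s] row by (simp add: Q_def)
      thus ?thesis
        using True by (simp add: emeasure_eq_measure)
    next
      case False
      thus ?thesis
        using row by (simp add: emeasure_eq_measure Q_def)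
    qed
    finally show "(\<integral>\<^sup>+\<omega>. (indicator {\<omega>. i \<in> B \<longleftrightarrow> \<not> (\<forall>j\<in>A. xi i j s \<omega> \<noteq> k)} \<omega> :: ennreal) \<partial>M) =
       (if i \<in> B then ennreal (1 - Q) else ennreal Q)" .
  qed
  also have "\<dots> = (\<Prod>i\<in>{1..N}. ennreal (if i \<in> B then 1 - Q else Q))"
    by (intro prod.cong) auto
  also have "\<dots> = ennreal (\<Prod>i\<in>{1..N}. if i \<in> B then 1 - Q else Q)"
    using Q by (intro prod_ennreal) auto
  also have "(\<Prod>i\<in>{1..N}. if i \<in> B then 1 - Q else Q) = (1 - Q) ^ card B * Q ^ (N - card B)"
  proof -
    have "{1..N} \<inter> {i. i \<in> B} = B" "{1..N} \<inter> - {i. i \<in> B} = {1..N} - B"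
      using B by auto
    thus ?thesis
      using B fin by (simp add: prod.If_cases card_Diff_subset)
  qed
  also have "(\<integral>\<^sup>+\<omega>. (\<Prod>i\<in>{1..N}. indicator {\<omega>. i \<in> B \<longleftrightarrow> \<not> (\<forall>j\<in>A. xi i j s \<omega> \<noteq> k)} \<omega>) \<partial>M) =
      (\<integral>\<^sup>+\<omega>. indicator {\<omega> \<in> space M. successors N k A (\<lambda>i j. xi i j s \<omega>) = B} \<omega> \<partial>M)"
  proof (intro nn_integral_cong)
    fix \<omega> assume \<omega>: "\<omega> \<in> space M"
    have iff: "(\<forall>i\<in>{1..N}. i \<in> B \<longleftrightarrow> \<not> (\<forall>j\<in>A. xi i j s \<omega> \<noteq> k)) \<longleftrightarrow> successors N k A (\<lambda>i j. xi i j s \<omega>) = B"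
      using successors_eq_iff[OF B, of k A "\<lambda>i j. xi i j s \<omega>"] by simp
    show "(\<Prod>i\<in>{1..N}. indicator {\<omega>. i \<in> B \<longleftrightarrow> \<not> (\<forall>j\<in>A. xi i j s \<omega> \<noteq> k)} \<omega>) =
      (indicator {\<omega> \<in> space M. successors N k A (\<lambda>i j. xi i j s \<omega>) = B} \<omega> :: ennreal)"
    proof (cases "successors N k A (\<lambda>i j. xi i j s \<omega>) = B")
      case True
      with iff have "\<forall>i\<in>{1..N}. i \<in> B \<longleftrightarrow> \<not> (\<forall>j\<in>A. xi i j s \<omega> \<noteq> k)" by blast
      with True \<omega> show ?thesis
        by (auto intro!: prod.neutral)
    next
      case False
      with iff obtain i where "i \<in> {1..N}" "\<not> (i \<in> B \<longleftrightarrow> \<not> (\<forall>j\<in>A. xi i j s \<omega> \<noteq> k))" by blast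
      hence "(\<Prod>i\<in>{1..N}. indicator {\<omega>. i \<in> B \<longleftrightarrow> \<not> (\<forall>j\<in>A. xi i j s \<omega> \<noteq> k)} \<omega>) = (0 :: ennreal)"
        by (intro prod_zero bexI[of _ i]) auto
      with False show ?thesis by simp
    qed
  qed
  also have "\<dots> = emeasure M {\<omega> \<in> space M. successors N k A (\<lambda>i j. xi i j s \<omega>) = B}"
    by (rule nn_integral_indicator[OF sets_successors[OF fin(1) B]])
  finally show ?thesis
    by (simp add: Q_def)
qed

text \<open>The probability of B depends only on its size, and \<open>N choose y\<close> sets share
  the size y: grouping them yields the binomial transition law, a function of \<open>card A\<close>
  alone.\<close>

lemma nn_integral_card_successors:
  assumes A: "A \<subseteq> {1..N}" and s: "s \<ge> 1" and \<phi>: "\<And>y. 0 \<le> \<phi> y"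
  shows "(\<integral>\<^sup>+\<omega>. ennreal (\<phi> (card (successors N k A (\<lambda>i j. xi i j s \<omega>)))) \<partial>M)
    = ennreal (\<Sum>y=0..N. trans_prob q N (card A) y * \<phi> y)"
proof -
  have fin: "finite A" using A finite_subset by blast
  define S where "S \<omega> = successors N k A (\<lambda>i j. xi i j s \<omega>)" for \<omega>
  define w where "w y = (1 - q ^ card A) ^ y * (q ^ card A) ^ (N - y)" for y
  have w0: "0 \<le> w y" for y
    using q_bounds by (auto simp: w_def power_le_one)
  have S: "S \<omega> \<subseteq> {1..N}" for \<omega>
    unfolding S_def by (rule successors_subset)
  have "(\<integral>\<^sup>+\<omega>. ennreal (\<phi> (card (S \<omega>))) \<partial>M) =
      (\<integral>\<^sup>+\<omega>. (\<Sum>B\<in>Pow {1..N}. ennreal (\<phi> (card B)) * indicator {\<omega> \<in> space M. S \<omega> = B} \<omega>) \<partial>M)"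
  proof (intro nn_integral_cong)
    fix \<omega> assume "\<omega> \<in> space M"
    hence "(\<Sum>B\<in>Pow {1..N}. ennreal (\<phi> (card B)) * indicator {\<omega> \<in> space M. S \<omega> = B} \<omega>) =
      (\<Sum>B\<in>Pow {1..N}. if B = S \<omega> then ennreal (\<phi> (card (S \<omega>))) else 0)"
      by (intro sum.cong) (auto simp: indicator_def)
    thus "ennreal (\<phi> (card (S \<omega>))) =
        (\<Sum>B\<in>Pow {1..N}. ennreal (\<phi> (card B)) * indicator {\<omega> \<in> space M. S \<omega> = B} \<omega>)"
      using S[of \<omega>] by simp
  qed
  also have "\<dots> = (\<Sum>B\<in>Pow {1..N}. ennreal (\<phi> (card B)) * emeasure M {\<omega> \<in> space M. S \<omega> = B})"
  proof (subst nn_integral_sum)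
    have m: "{\<omega> \<in> space M. S \<omega> = B} \<in> sets M" if "B \<in> Pow {1..N}" for B
      unfolding S_def using fin that by (intro sets_successors) auto
    show "(\<lambda>\<omega>. ennreal (\<phi> (card B)) * indicator {\<omega> \<in> space M. S \<omega> = B} \<omega>) \<in> borel_measurable M"
      if "B \<in> Pow {1..N}" for B
      using m[OF that] by measurable
    show "(\<Sum>B\<in>Pow {1..N}. \<integral>\<^sup>+\<omega>. ennreal (\<phi> (card B)) * indicator {\<omega> \<in> space M. S \<omega> = B} \<omega> \<partial>M) =
      (\<Sum>B\<in>Pow {1..N}. ennreal (\<phi> (card B)) * emeasure M {\<omega> \<in> space M. S \<omega> = B})"
      by (intro sum.cong refl nn_integral_cmult_indicator m)
  qed
  also have "\<dots> = (\<Sum>B\<in>Pow {1..N}. ennreal (\<phi> (card B) * w (card B)))"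
    unfolding S_def w_def using emeasure_successors_eq[OF A s] \<phi>
    by (intro sum.cong) (auto simp: ennreal_mult')
  also have "\<dots> = ennreal (\<Sum>B\<in>Pow {1..N}. \<phi> (card B) * w (card B))"
    using \<phi> w0 by (intro sum_ennreal) auto
  also have "(\<Sum>B\<in>Pow {1..N}. \<phi> (card B) * w (card B)) =
      (\<Sum>y=0..N. \<Sum>B\<in>{B \<in> Pow {1..N}. card B = y}. \<phi> (card B) * w (card B))"
    using card_mono[of "{1..N}"] by (intro sum.group[symmetric]) auto
  also have "\<dots> = (\<Sum>y=0..N. trans_prob q N (card A) y * \<phi> y)"
  proof (intro sum.cong refl)
    fix y
    have "card {B \<in> Pow {1..N}. card B = y} = N choose y"
      using n_subsets[of "{1..N}" y] by simp
    hence "(\<Sum>B\<in>{B \<in> Pow {1..N}. card B = y}. \<phi> (card B) * w (card B)) = real (N choose y) * (\<phi> y * w y)"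
      by simp
    thus "(\<Sum>B\<in>{B \<in> Pow {1..N}. card B = y}. \<phi> (card B) * w (card B)) = trans_prob q N (card A) y * \<phi> y"
      by (simp add: w_def trans_prob_def)
  qed
  finally show ?thesis
    by (simp add: S_def)
qed

text \<open>The product of these factors over all edges leaving \<open>A\<close> vanishes unless no edge carries \<open>k\<close> or \<open>k - 1\<close>
  (one distinguished edge left aside); it then bounds the loss by that of the distinguished edge. Its
  expectation factorizes, which makes losses greater than 1 negligible.\<close>

definition loss_bound :: "nat \<Rightarrow> nat set \<Rightarrow> nat \<times> nat \<times> nat \<Rightarrow> int \<Rightarrow> ennreal" where
  "loss_bound t A p v = (if p = (1, Min A, Suc t) then ennreal (real_of_int (k - v)) else indicator (- {k, k - 1}) v)"

text \<open>Each ordinary edge contributes r and the distinguished one at most m, whence the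
  exponent is one short of the number of edges. The distinguished edge is a function of A alone, so
  it is deterministic once A is fixed.\<close>

lemma nn_integral_loss_bound:
  assumes A: "A \<subseteq> {1..N}" "A \<noteq> {}"
  shows "(\<integral>\<^sup>+\<omega>. (\<Prod>p\<in>{1..N} \<times> A \<times> {Suc t}. loss_bound t A p ((\<lambda>(i, j, s). xi i j s) p \<omega>)) \<partial>M)
     \<le> ennreal (m * r ^ (N * card A - 1))"
proof -
  have fin: "finite A" using A finite_subset by blast
  define I where "I = {1..N} \<times> A \<times> {Suc t}"
  have I: "I \<subseteq> {1..N} \<times> {1..N} \<times> {1..}" "finite I"
    using A fin by (auto simp: I_def)
  define o0 where "o0 = (1::nat, Min A, Suc t)"
  have MinA: "Min A \<in> A" using A fin by simp
  hence o0: "o0 \<in> I" using N by (auto simp: I_def o0_def)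
  have "indep_vars (\<lambda>_. borel) (\<lambda>p \<omega>. loss_bound t A p ((\<lambda>(i, j, s). xi i j s) p \<omega>)) I"
    by (rule indep_vars_compose2[OF indep_vars_subset[OF indep I(1)]]) simp
  from indep_vars_nn_integral[OF I(2) this]
  have "(\<integral>\<^sup>+\<omega>. (\<Prod>p\<in>I. loss_bound t A p ((\<lambda>(i, j, s). xi i j s) p \<omega>)) \<partial>M) =
      (\<Prod>p\<in>I. \<integral>\<^sup>+\<omega>. loss_bound t A p ((\<lambda>(i, j, s). xi i j s) p \<omega>) \<partial>M)"
    by simp
  also have "\<dots> = (\<integral>\<^sup>+\<omega>. loss_bound t A o0 ((\<lambda>(i, j, s). xi i j s) o0 \<omega>) \<partial>M) *
      (\<Prod>p\<in>I - {o0}. \<integral>\<^sup>+\<omega>. loss_bound t A p ((\<lambda>(i, j, s). xi i j s) p \<omega>) \<partial>M)"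
    using I(2) o0 by (rule prod.remove)
  also have "(\<Prod>p\<in>I - {o0}. \<integral>\<^sup>+\<omega>. loss_bound t A p ((\<lambda>(i, j, s). xi i j s) p \<omega>) \<partial>M) = (\<Prod>p\<in>I - {o0}. ennreal r)"
  proof (intro prod.cong refl)
    fix p assume p: "p \<in> I - {o0}"
    then obtain i j where ij: "p = (i, j, Suc t)" "i \<in> {1..N}" "j \<in> {1..N}" using A by (auto simp: I_def)
    have "(\<integral>\<^sup>+\<omega>. loss_bound t A p ((\<lambda>(i, j, s). xi i j s) p \<omega>) \<partial>M) =
      (\<integral>\<^sup>+\<omega>. indicator {\<omega> \<in> space M. xi i j (Suc t) \<omega> \<notin> {k, k - 1}} \<omega> \<partial>M)"
      using p ij by (intro nn_integral_cong) (auto simp: loss_bound_def indicator_def o0_def)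
    also have "\<dots> = emeasure M {\<omega> \<in> space M. xi i j (Suc t) \<omega> \<notin> {k, k - 1}}"
      by (intro nn_integral_indicator measurable_sets_Collect[OF rv, of "\<lambda>v. v \<notin> {k, k - 1}"]) simp
    also have "\<dots> = ennreal r"
      using prob_low[of i j "Suc t"] ij by (simp add: emeasure_eq_measure)
    finally show "(\<integral>\<^sup>+\<omega>. loss_bound t A p ((\<lambda>(i, j, s). xi i j s) p \<omega>) \<partial>M) = ennreal r" .
  qed
  also have "(\<Prod>p\<in>I - {o0}. ennreal r) = ennreal (r ^ (N * card A - 1))"
    using o0 I r_nonneg by (simp add: I_def card_cartesian_product ennreal_power)
  also have "(\<integral>\<^sup>+\<omega>. loss_bound t A o0 ((\<lambda>(i, j, s). xi i j s) o0 \<omega>) \<partial>M) \<le> ennreal m"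
    using mean[of 1 "Min A" "Suc t"] MinA A N by (auto simp: loss_bound_def o0_def)
  finally show ?thesis
    using m_nonneg r_nonneg by (simp add: I_def ennreal_mult mult_right_mono)
qed

section \<open>The loss in one step\<close>

definition front_pos :: "nat \<Rightarrow> 'a \<Rightarrow> real" where
  "front_pos t \<omega> = top_pos N (\<lambda>_. 0) (env \<omega>) t"

text \<open>The successors as a function of the draw, hence measurable on the product space and
  admissible in \<open>markov_step\<close>.\<close>

definition children :: "nat \<Rightarrow> nat set \<Rightarrow> (nat \<times> nat \<times> nat \<Rightarrow> int) \<Rightarrow> nat set" where
  "children t A x = successors N k A (\<lambda>i j. x (i, j, Suc t))"

lemma children_draw:
  "A \<subseteq> {1..N} \<Longrightarrow> children t A (draw t \<omega>) = successors N k A (\<lambda>i j. xi i j (Suc t) \<omega>)"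
  unfolding children_def by (rule successors_cong) (auto simp: draw_def slice_def)

lemma next_leaders_eq: "next_leaders N k (\<lambda>_. 0) (env \<omega>) t = children t (front t \<omega>) (draw t \<omega>)"
  using children_draw[OF front_subset[of t \<omega>], of t] by (simp add: front_def env_def)

lemma finite_children: "finite (children t A x)"
  unfolding children_def by (rule finite_subset[OF successors_subset]) simp

lemma measurable_children:
  assumes "A \<subseteq> {1..N}"
  shows "(\<lambda>x. g (children t A x)) \<in> measurable (PiM (slice t) (\<lambda>_. count_space UNIV)) (borel :: ennreal measure)"
proof -
  have "finite A" using assms finite_subset by blast
  hence "(\<lambda>x. children t A x) \<in> measurable (PiM (slice t) (\<lambda>_. count_space UNIV)) (count_space (Pow {1..N}))"
    unfolding children_def using assms
    by (intro measurable_successors measurable_component_singleton) (auto simp: slice_def)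
  thus ?thesis
    by (rule measurable_compose) simp
qed

lemma measurable_card_children:
  "A \<subseteq> {1..N} \<Longrightarrow>
    (\<lambda>x. ennreal (\<phi> (card (children t A x)))) \<in> borel_measurable (PiM (slice t) (\<lambda>_. count_space UNIV))"
  by (rule measurable_children[where g = "\<lambda>B. ennreal (\<phi> (card B))"])

lemma nn_integral_children:
  assumes "A \<subseteq> {1..N}" "\<And>y. 0 \<le> \<phi> y"
  shows "(\<integral>\<^sup>+\<omega>. ennreal (\<phi> (card (children t A (draw t \<omega>)))) \<partial>M)
    = ennreal (\<Sum>y=0..N. trans_prob q N (card A) y * \<phi> y)"
  using nn_integral_card_successors[OF assms(1) _ assms(2), of "Suc t"] by (simp add: children_draw[OF assms(1)])

lemma AE_le_k: "AE \<omega> in M. \<forall>i\<in>{1..N}. \<forall>j\<in>{1..N}. \<forall>s\<in>{1..}. xi i j s \<omega> \<le> k"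
  using le_k by (intro AE_ball_countable' ) auto

lemma measurable_front_pos [measurable]: "front_pos t \<in> borel_measurable M"
  unfolding front_pos_def using N rv by (intro measurable_top_pos) (auto simp: env_def)

lemma front_pos_0: "front_pos 0 \<omega> = 0"
  using N by (simp add: front_pos_def top_pos_def image_constant_conv)

context
  fixes \<omega> :: "'a" and t :: nat assumes le: "\<forall>i\<in>{1..N}. \<forall>j\<in>{1..N}. \<forall>s\<in>{1..}. xi i j s \<omega> \<le> k"
begin

lemma env_le: "i \<in> {1..N} \<Longrightarrow> j \<in> {1..N} \<Longrightarrow> env \<omega> i j (Suc t) \<le> k"
  using le by (auto simp: env_def)

lemma front_pos_extinct:
  "children t (front t \<omega>) (draw t \<omega>) = {} \<Longrightarrow> front_pos (Suc t) \<omega> \<le> front_pos t \<omega> + k - 1"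
  unfolding front_pos_def 
  using top_pos_step_extinct[where e = "env \<omega>" and ?X0.0 = "\<lambda>_. 0" and k = k and t = t, OF N _ env_le]
  by (simp add: next_leaders_eq)

lemma front_pos_survive:
  "children t (front t \<omega>) (draw t \<omega>) \<noteq> {} \<Longrightarrow> front_pos (Suc t) \<omega> = front_pos t \<omega> + k"
  unfolding front_pos_def 
  using top_pos_step_survive[where e = "env \<omega>" and ?X0.0 = "\<lambda>_. 0" and k = k and t = t, OF N _ env_le]
  by (simp add: next_leaders_eq)

lemma front_survive:
  "children t (front t \<omega>) (draw t \<omega>) \<noteq> {} \<Longrightarrow> front (Suc t) \<omega> = children t (front t \<omega>) (draw t \<omega>)"
  unfolding front_def[of "Suc t"] 
  using leaders_step_survive[where e = "env \<omega>" and ?X0.0 = "\<lambda>_. 0" and k = k and t = t, OF N _ env_le]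
  by (simp add: next_leaders_eq)

text \<open>With a successor nothing is lost; without one, an edge carrying k - 1 limits the loss to
  1; if there is no such edge either, all indicators equal 1 and the product is the deficit of the
  distinguished edge, which bounds the loss.\<close>

lemma loss_step:
  "ennreal (real_of_int k * real (Suc t) - front_pos (Suc t) \<omega>) \<le> ennreal (real_of_int k * real t - front_pos t \<omega>) +
     (ennreal (of_bool (children t (front t \<omega>) (draw t \<omega>) = {})) +
      (\<Prod>p\<in>{1..N} \<times> front t \<omega> \<times> {Suc t}. loss_bound t (front t \<omega>) p (draw t \<omega> p)))"
proof -
  define A where "A = front t \<omega>"
  define I where "I = {1..N} \<times> A \<times> {Suc t}"
  have A: "A \<subseteq> {1..N}" "A \<noteq> {}" "finite A"
    using front_subset front_nonempty finite_subset[OF front_subset] by (auto simp: A_def)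
  have draw: "draw t \<omega> (i, j, Suc t) = xi i j (Suc t) \<omega>" if "i \<in> {1..N}" "j \<in> A" for i j
    using that A by (auto simp: draw_def slice_def)
  have ge: "front_pos t \<omega> + real_of_int (xi i j (Suc t) \<omega>) \<le> front_pos (Suc t) \<omega>" if "i \<in> {1..N}" "j \<in> A" for i j
    using top_pos_step_ge[of j N "\<lambda>_. 0" "env \<omega>" t i] that by (simp add: A_def front_def front_pos_def env_def)
  consider "children t A (draw t \<omega>) \<noteq> {}"
    | "children t A (draw t \<omega>) = {}" "\<exists>i\<in>{1..N}. \<exists>j\<in>A. xi i j (Suc t) \<omega> \<in> {k, k - 1}"
    | "children t A (draw t \<omega>) = {}" "\<forall>i\<in>{1..N}. \<forall>j\<in>A. xi i j (Suc t) \<omega> \<notin> {k, k - 1}"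
    by blast
  thus ?thesis
  proof cases
    case 1
    hence "real_of_int k * real (Suc t) - front_pos (Suc t) \<omega> = real_of_int k * real t - front_pos t \<omega>"
      using front_pos_survive by (simp add: A_def algebra_simps)
    thus ?thesis by simp
  next
    case 2
    then obtain i j where ij: "i \<in> {1..N}" "j \<in> A" "xi i j (Suc t) \<omega> \<ge> k - 1"
      by force
    hence "real_of_int (xi i j (Suc t) \<omega>) \<ge> real_of_int k - 1"
      by linarith
    hence "real_of_int k * real (Suc t) - front_pos (Suc t) \<omega> \<le> (real_of_int k * real t - front_pos t \<omega>) + 1"
      using ge[OF ij(1,2)] by (simp add: algebra_simps)
    hence "ennreal (real_of_int k * real (Suc t) - front_pos (Suc t) \<omega>) \<le>
      ennreal (real_of_int k * real t - front_pos t \<omega>) + ennreal 1"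
      by (rule ennreal_le_add) simp
    also have "\<dots> \<le> ennreal (real_of_int k * real t - front_pos t \<omega>) + (ennreal 1 +
      (\<Prod>p\<in>{1..N} \<times> front t \<omega> \<times> {Suc t}. loss_bound t (front t \<omega>) p (draw t \<omega> p)))"
      by (intro add_left_mono) simp
    finally show ?thesis
      using 2 by (simp add: A_def)
  next
    case 3
    have Min: "Min A \<in> A" using A by simp
    have one: "1 \<in> {1..N}" using N by simp
    have "(\<Prod>p\<in>I. loss_bound t A p (draw t \<omega> p)) =
      loss_bound t A (1, Min A, Suc t) (draw t \<omega> (1, Min A, Suc t)) *
      (\<Prod>p\<in>I - {(1, Min A, Suc t)}. loss_bound t A p (draw t \<omega> p))"
      using A Min one by (intro prod.remove) (auto simp: I_def)
    also have "(\<Prod>p\<in>I - {(1, Min A, Suc t)}. loss_bound t A p (draw t \<omega> p)) = 1"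
    proof (intro prod.neutral ballI)
      fix p assume p: "p \<in> I - {(1, Min A, Suc t)}"
      then obtain i j where "p = (i, j, Suc t)" "i \<in> {1..N}" "j \<in> A" by (auto simp: I_def)
      thus "loss_bound t A p (draw t \<omega> p) = 1"
        using p 3 draw[of i j] by (auto simp: loss_bound_def)
    qed
    also have "loss_bound t A (1, Min A, Suc t) (draw t \<omega> (1, Min A, Suc t)) =
        ennreal (real_of_int (k - xi 1 (Min A) (Suc t) \<omega>))"
      using draw[OF one Min] by (simp add: loss_bound_def)
    finally have prod: "(\<Prod>p\<in>I. loss_bound t A p (draw t \<omega> p)) = ennreal (real_of_int (k - xi 1 (Min A) (Suc t) \<omega>))"
      by simp
    have "ennreal (real_of_int k * real (Suc t) - front_pos (Suc t) \<omega>) \<le>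
      ennreal (real_of_int k * real t - front_pos t \<omega>) + ennreal (real_of_int (k - xi 1 (Min A) (Suc t) \<omega>))"
    proof (rule ennreal_le_add)
      show "real_of_int k * real (Suc t) - front_pos (Suc t) \<omega> \<le>
        (real_of_int k * real t - front_pos t \<omega>) + real_of_int (k - xi 1 (Min A) (Suc t) \<omega>)"
        using ge[OF one Min] by (simp add: algebra_simps)
      show "0 \<le> real_of_int (k - xi 1 (Min A) (Suc t) \<omega>)"
        using env_le[OF one subsetD[OF A(1) Min]] by (simp add: env_def)
    qed
    also have "\<dots> \<le> ennreal (real_of_int k * real t - front_pos t \<omega>) + (ennreal (of_bool (children t A (draw t \<omega>) = {})) +
      (\<Prod>p\<in>I. loss_bound t A p (draw t \<omega> p)))"
      unfolding prod by (intro add_left_mono) (simp add: add_increasing)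
    finally show ?thesis
      by (simp add: A_def I_def)
  qed
qed

end

section \<open>Lower bound on the speed\<close>

lemma measurable_H_front [measurable]: "(\<lambda>\<omega>. ennreal (H (card (front t \<omega>)))) \<in> borel_measurable M"
  by (rule measurable_front_draw[of "\<lambda>A _. ennreal (H (card A))"]) simp

text \<open>A drift inequality for accumulated loss plus potential. In \<open>drift\<close> the
  first term is a loss, charged 1 for itself and K for the unknown state it leads to, the second
  bounds the losses larger than 1, and the sum is the expected potential after survival.\<close>

lemma expected_loss_step:
  fixes H :: "nat \<Rightarrow> real"
  assumes H0: "\<And>y. 0 \<le> H y" and HK: "\<And>y. y \<in> {1..N} \<Longrightarrow> H y \<le> K" and K: "0 \<le> K" and c: "0 \<le> c"
    and drift: "\<And>z. z \<in> {1..N} \<Longrightarrow>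
      q ^ (N * z) * (1 + K) + m * r ^ (N * z - 1) + (\<Sum>y=1..N. trans_prob q N z y * H y) \<le> H z + c"
  shows "(\<integral>\<^sup>+\<omega>. ennreal (real_of_int k * real (Suc t) - front_pos (Suc t) \<omega>) + ennreal (H (card (front (Suc t) \<omega>))) \<partial>M)
    \<le> (\<integral>\<^sup>+\<omega>. ennreal (real_of_int k * real t - front_pos t \<omega>) + ennreal (H (card (front t \<omega>))) \<partial>M) + ennreal c"
proof -
  \<comment> \<open>State 0 stands for a loss: it costs 1, and the leaders that follow it are known
    only to have potential at most K.\<close>
  define \<phi> where "\<phi> y = (if y = 0 then 1 + K else H y)" for y
  have \<phi>0: "0 \<le> \<phi> y" for y
    using H0 K by (simp add: \<phi>_def)
  define F where "F A x = ennreal (\<phi> (card (children t A x))) +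
      (\<Prod>p\<in>{1..N} \<times> A \<times> {Suc t}. loss_bound t A p (x p))" for A x
  have lbm: "(\<lambda>x. \<Prod>p\<in>{1..N} \<times> A \<times> {Suc t}. loss_bound t A p (x p)) \<in> borel_measurable (PiM (slice t) (\<lambda>_. count_space UNIV))"
    if "A \<subseteq> {1..N}" for A
  proof (rule borel_measurable_prod_ennreal)
    fix p assume "p \<in> {1..N} \<times> A \<times> {Suc t}"
    hence "p \<in> slice t" using that by (auto simp: slice_def)
    hence "(\<lambda>x. x p) \<in> measurable (PiM (slice t) (\<lambda>_. count_space UNIV)) (count_space (UNIV :: int set))"
      by (rule measurable_component_singleton)
    thus "(\<lambda>x. loss_bound t A p (x p)) \<in> borel_measurable (PiM (slice t) (\<lambda>_. count_space UNIV))"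
      by (rule measurable_compose) simp
  qed
  have Fm: "F A \<in> borel_measurable (PiM (slice t) (\<lambda>_. count_space UNIV))" if "A \<subseteq> {1..N}" for A
    unfolding F_def using that
    by (intro borel_measurable_add lbm measurable_card_children)
  have "(\<integral>\<^sup>+\<omega>. ennreal (real_of_int k * real (Suc t) - front_pos (Suc t) \<omega>) + ennreal (H (card (front (Suc t) \<omega>))) \<partial>M)
    \<le> (\<integral>\<^sup>+\<omega>. ennreal (real_of_int k * real t - front_pos t \<omega>) + F (front t \<omega>) (draw t \<omega>) \<partial>M)"
  proof (rule nn_integral_mono_AE, use AE_le_k in eventually_elim)
    fix \<omega> assume le: "\<forall>i\<in>{1..N}. \<forall>j\<in>{1..N}. \<forall>s\<in>{1..}. xi i j s \<omega> \<le> k"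
    define C where "C = children t (front t \<omega>) (draw t \<omega>)"
    have "ennreal (of_bool (C = {})) + ennreal (H (card (front (Suc t) \<omega>))) \<le> ennreal (\<phi> (card C))"
    proof (cases "C = {}")
      case True
      thus ?thesis
        using HK[OF card_front] H0 by (simp add: \<phi>_def ennreal_leI flip: ennreal_plus ennreal_1)
    next
      case False
      moreover have "card C \<noteq> 0"
        using False finite_children by (simp add: C_def)
      ultimately show ?thesis
        using front_survive[OF le, of t] by (simp add: \<phi>_def C_def)
    qed
    note drift_step = this
    define P where "P = (\<Prod>p\<in>{1..N} \<times> front t \<omega> \<times> {Suc t}. loss_bound t (front t \<omega>) p (draw t \<omega> p))"
    have "ennreal (real_of_int k * real (Suc t) - front_pos (Suc t) \<omega>) + ennreal (H (card (front (Suc t) \<omega>)))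
      \<le> ennreal (real_of_int k * real t - front_pos t \<omega>) + (ennreal (of_bool (C = {})) + P) + ennreal (H (card (front (Suc t) \<omega>)))"
      using loss_step[OF le, of t] unfolding C_def P_def by (rule add_right_mono)
    also have "\<dots> = ennreal (real_of_int k * real t - front_pos t \<omega>) +
        ((ennreal (of_bool (C = {})) + ennreal (H (card (front (Suc t) \<omega>)))) + P)"
      by (simp only: ac_simps)
    also have "\<dots> \<le> ennreal (real_of_int k * real t - front_pos t \<omega>) + (ennreal (\<phi> (card C)) + P)"
      by (intro add_left_mono add_right_mono drift_step)
    finally show "ennreal (real_of_int k * real (Suc t) - front_pos (Suc t) \<omega>) + ennreal (H (card (front (Suc t) \<omega>)))
      \<le> ennreal (real_of_int k * real t - front_pos t \<omega>) + F (front t \<omega>) (draw t \<omega>)"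
      by (simp only: F_def C_def P_def)
  qed
  also have "\<dots> = (\<integral>\<^sup>+\<omega>. ennreal (real_of_int k * real t - front_pos t \<omega>) \<partial>M) + (\<integral>\<^sup>+\<omega>. F (front t \<omega>) (draw t \<omega>) \<partial>M)"
    using measurable_front_draw[OF Fm] by (intro nn_integral_add) auto
  also have "(\<integral>\<^sup>+\<omega>. F (front t \<omega>) (draw t \<omega>) \<partial>M) \<le> (\<integral>\<^sup>+\<omega>. ennreal (H (card (front t \<omega>)) + c) \<partial>M)"
  proof (rule markov_step_mono[where G = "\<lambda>A _. ennreal (H (card A) + c)"])
    fix A assume A: "A \<subseteq> {1..N}" "A \<noteq> {}"
    have z: "card A \<in> {1..N}"
      using A card_mono[OF _ A(1)] by (auto simp: Suc_le_eq card_gt_0_iff intro: finite_subset)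
    have "(\<integral>\<^sup>+\<omega>. F A (draw t \<omega>) \<partial>M) = (\<integral>\<^sup>+\<omega>. ennreal (\<phi> (card (children t A (draw t \<omega>)))) \<partial>M) +
        (\<integral>\<^sup>+\<omega>. (\<Prod>p\<in>{1..N} \<times> A \<times> {Suc t}. loss_bound t A p (draw t \<omega> p)) \<partial>M)"
      unfolding F_def using A
      by (intro nn_integral_add measurable_compose[OF measurable_draw lbm]
        measurable_compose[OF measurable_draw measurable_card_children])
    also have "(\<integral>\<^sup>+\<omega>. (\<Prod>p\<in>{1..N} \<times> A \<times> {Suc t}. loss_bound t A p (draw t \<omega> p)) \<partial>M) =
       (\<integral>\<^sup>+\<omega>. (\<Prod>p\<in>{1..N} \<times> A \<times> {Suc t}. loss_bound t A p ((\<lambda>(i, j, s). xi i j s) p \<omega>)) \<partial>M)"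
      using A by (intro nn_integral_cong prod.cong refl) (auto simp: draw_def slice_def subset_iff)
    also have "\<dots> \<le> ennreal (m * r ^ (N * card A - 1))"
      using A by (rule nn_integral_loss_bound)
    also have "(\<integral>\<^sup>+\<omega>. ennreal (\<phi> (card (children t A (draw t \<omega>)))) \<partial>M) =
        ennreal (\<Sum>y=0..N. trans_prob q N (card A) y * \<phi> y)"
      using A(1) \<phi>0 by (rule nn_integral_children)
    also have "(\<Sum>y=0..N. trans_prob q N (card A) y * \<phi> y) =
        q ^ (N * card A) * (1 + K) + (\<Sum>y=1..N. trans_prob q N (card A) y * H y)"
    proof -
      have "(\<Sum>y=0..N. trans_prob q N (card A) y * \<phi> y) =
          trans_prob q N (card A) 0 * \<phi> 0 + (\<Sum>y=1..N. trans_prob q N (card A) y * \<phi> y)"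
        by (simp add: sum.atLeast_Suc_atMost)
      also have "(\<Sum>y=1..N. trans_prob q N (card A) y * \<phi> y) = (\<Sum>y=1..N. trans_prob q N (card A) y * H y)"
        by (intro sum.cong) (auto simp: \<phi>_def)
      finally show ?thesis
        by (simp add: trans_prob_def \<phi>_def mult.commute flip: power_mult)
    qed
    also have "ennreal (q ^ (N * card A) * (1 + K) + (\<Sum>y=1..N. trans_prob q N (card A) y * H y)) +
        ennreal (m * r ^ (N * card A - 1)) =
      ennreal (q ^ (N * card A) * (1 + K) + m * r ^ (N * card A - 1) + (\<Sum>y=1..N. trans_prob q N (card A) y * H y))"
      using q_bounds K H0 m_nonneg r_nonneg
      by (subst ennreal_plus[symmetric]) (auto simp: add_ac intro!: add_nonneg_nonneg sum_nonneg mult_nonneg_nonneg trans_prob_nonneg)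
    also have "\<dots> \<le> ennreal (H (card A) + c)"
      using drift[OF z] by (rule ennreal_leI)
    also have "\<dots> = (\<integral>\<^sup>+\<omega>. ennreal (H (card A) + c) \<partial>M)"
      by (simp add: emeasure_space_1)
    finally show "(\<integral>\<^sup>+\<omega>. F A (draw t \<omega>) \<partial>M) \<le> (\<integral>\<^sup>+\<omega>. ennreal (H (card A) + c) \<partial>M)"
      by (simp add: add_left_mono)
  qed (use Fm in auto)
  also have "(\<integral>\<^sup>+\<omega>. ennreal (H (card (front t \<omega>)) + c) \<partial>M) = (\<integral>\<^sup>+\<omega>. ennreal (H (card (front t \<omega>))) \<partial>M) + ennreal c"
  proof -
    have "(\<integral>\<^sup>+\<omega>. ennreal (H (card (front t \<omega>)) + c) \<partial>M) = (\<integral>\<^sup>+\<omega>. ennreal (H (card (front t \<omega>))) + ennreal c \<partial>M)"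
      using H0 c by (simp add: ennreal_plus)
    also have "\<dots> = (\<integral>\<^sup>+\<omega>. ennreal (H (card (front t \<omega>))) \<partial>M) + (\<integral>\<^sup>+\<omega>. ennreal c \<partial>M)"
      by (rule nn_integral_add) measurable
    finally show ?thesis
      by (simp add: emeasure_space_1)
  qed
  also have "(\<integral>\<^sup>+\<omega>. ennreal (real_of_int k * real t - front_pos t \<omega>) \<partial>M) + ((\<integral>\<^sup>+\<omega>. ennreal (H (card (front t \<omega>))) \<partial>M) + ennreal c)
     = (\<integral>\<^sup>+\<omega>. ennreal (real_of_int k * real t - front_pos t \<omega>) + ennreal (H (card (front t \<omega>))) \<partial>M) + ennreal c"
    by (simp add: nn_integral_add add.assoc)
  finally show ?thesis
    by (simp add: add_left_mono)
qed

text \<open>Adding up the drift gives an expected loss of at most K + t c by time t, where K also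
  bounds the initial potential. After division by t only c survives.\<close>

lemma speed_ge:
  fixes H :: "nat \<Rightarrow> real"
  assumes H0: "\<And>y. 0 \<le> H y" and HK: "\<And>y. y \<in> {1..N} \<Longrightarrow> H y \<le> K" and K: "0 \<le> K" and c: "0 \<le> c"
    and drift: "\<And>z. z \<in> {1..N} \<Longrightarrow>
      q ^ (N * z) * (1 + K) + m * r ^ (N * z - 1) + (\<Sum>y=1..N. trans_prob q N z y * H y) \<le> H z + c"
    and lim: "AE \<omega> in M. (\<lambda>t. front_pos t \<omega> / real t) \<longlonglongrightarrow> v"
  shows "real_of_int k - v \<le> c"
proof (rule limit_le_of_nn_integral_le)
  have *: "(\<integral>\<^sup>+\<omega>. ennreal (real_of_int k * real t - front_pos t \<omega>) + ennreal (H (card (front t \<omega>))) \<partial>M)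
      \<le> ennreal (K + real t * c)" for t
  proof (induction t)
    case 0
    have "(\<integral>\<^sup>+\<omega>. ennreal (real_of_int k * real 0 - front_pos 0 \<omega>) + ennreal (H (card (front 0 \<omega>))) \<partial>M) \<le>
        (\<integral>\<^sup>+\<omega>. ennreal K \<partial>M)"
      using HK[OF card_front] by (intro nn_integral_mono) (simp add: front_pos_0 ennreal_leI)
    thus ?case
      by (simp add: emeasure_space_1)
  next
    case (Suc t)
    have "(\<integral>\<^sup>+\<omega>. ennreal (real_of_int k * real (Suc t) - front_pos (Suc t) \<omega>) + ennreal (H (card (front (Suc t) \<omega>))) \<partial>M)
      \<le> (\<integral>\<^sup>+\<omega>. ennreal (real_of_int k * real t - front_pos t \<omega>) + ennreal (H (card (front t \<omega>))) \<partial>M) + ennreal c"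
      using H0 HK K c drift by (rule expected_loss_step)
    also have "\<dots> \<le> ennreal (K + real t * c) + ennreal c"
      using Suc.IH by (rule add_right_mono)
    also have "\<dots> = ennreal (K + real (Suc t) * c)"
      using K c by (simp add: ennreal_plus[symmetric] algebra_simps del: ennreal_plus)
    finally show ?case .
  qed
  show "(\<lambda>\<omega>. real_of_int k - front_pos t \<omega> / real t) \<in> borel_measurable M" for t
    by measurable
  show "AE \<omega> in M. (\<lambda>t. real_of_int k - front_pos t \<omega> / real t) \<longlonglongrightarrow> real_of_int k - v"
    using lim by eventually_elim (intro tendsto_intros)
  show "\<forall>\<^sub>F t in sequentially. (\<integral>\<^sup>+\<omega>. ennreal (real_of_int k - front_pos t \<omega> / real t) \<partial>M) \<le> ennreal (K / real t + c)"
    using eventually_gt_at_top[of 0]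
  proof eventually_elim
    case (elim t)
    have "(\<integral>\<^sup>+\<omega>. ennreal (real_of_int k - front_pos t \<omega> / real t) \<partial>M) =
        (\<integral>\<^sup>+\<omega>. ennreal (1 / real t) * ennreal (real_of_int k * real t - front_pos t \<omega>) \<partial>M)"
      using elim by (intro nn_integral_cong) (simp add: ennreal_mult'[symmetric] diff_divide_distrib)
    also have "\<dots> = ennreal (1 / real t) * (\<integral>\<^sup>+\<omega>. ennreal (real_of_int k * real t - front_pos t \<omega>) \<partial>M)"
      by (rule nn_integral_cmult) measurable
    also have "\<dots> \<le> ennreal (1 / real t) * ennreal (K + real t * c)"
      by (intro mult_left_mono order.trans[OF nn_integral_mono *[of t]]) auto
    also have "\<dots> = ennreal (K / real t + c)"
      using elim K c by (simp add: ennreal_mult[symmetric] add_divide_distrib del: ennreal_plus)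
    finally show ?case .
  qed
  have "(\<lambda>t. K / real t) \<longlonglongrightarrow> 0"
    by (rule lim_const_over_n)
  thus "(\<lambda>t. K / real t + c) \<longlonglongrightarrow> c"
    using tendsto_add[OF _ tendsto_const[of c]] by fastforce
qed (fact c)

section \<open>Upper bound on the speed\<close>

lemma children_front_measurable:
  "(\<lambda>\<omega>. ennreal (\<phi> (card (children t (front t \<omega>) (draw t \<omega>))))) \<in> borel_measurable M"
  by (rule measurable_front_draw[of "\<lambda>A x. ennreal (\<phi> (card (children t A x)))"])
     (rule measurable_card_children)

text \<open>Two Markov steps back to back: whatever the leaders at time t, the step after the next
  one is a loss with probability at least c. The bound c \<le> 1 keeps 1 - c meaningful in
  \<open>ennreal\<close>.\<close>

lemma nn_integral_survive_le:
  assumes c: "\<And>z. z \<in> {1..N} \<Longrightarrow> c \<le> hit2 q N z"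
  shows "(\<integral>\<^sup>+\<omega>. ennreal (of_bool (children (Suc t) (front (Suc t) \<omega>) (draw (Suc t) \<omega>) \<noteq> {})) \<partial>M) \<le> ennreal (1 - c)"
    and "c \<le> 1"
proof -
  define E where "E = {\<omega> \<in> space M. children (Suc t) (front (Suc t) \<omega>) (draw (Suc t) \<omega>) = {}}"
  have E: "E \<in> sets M"
  proof -
    have "(\<lambda>\<omega>. ennreal (of_bool (card (children (Suc t) (front (Suc t) \<omega>) (draw (Suc t) \<omega>)) = 0))) \<in> borel_measurable M"
      by (rule children_front_measurable)
    hence "(\<lambda>\<omega>. ennreal (of_bool (card (children (Suc t) (front (Suc t) \<omega>) (draw (Suc t) \<omega>)) = 0))) -` {1} \<inter> space M \<in> sets M"
      by (rule measurable_sets) simp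
    moreover have "(\<lambda>\<omega>. ennreal (of_bool (card (children (Suc t) (front (Suc t) \<omega>) (draw (Suc t) \<omega>)) = 0))) -` {1} \<inter> space M = E"
      using finite_children by (auto simp: E_def)
    ultimately show ?thesis
      by simp
  qed
  \<comment> \<open>The value 0 at y = 0 discards the paths that already lose at the first of the
    two steps, after which the number of leaders is unknown.\<close>
  define \<psi> :: "nat \<Rightarrow> real" where "\<psi> y = (if y = 0 then 0 else q ^ (N * y))" for y
  have \<psi>0: "0 \<le> \<psi> y" for y
    using q_bounds by (simp add: \<psi>_def)
  have card_pos: "card A \<in> {1..N}" if "A \<subseteq> {1..N}" "A \<noteq> {}" for A
    using that card_mono[OF _ that(1)] by (auto simp: Suc_le_eq card_gt_0_iff intro: finite_subset)
  have "ennreal c = (\<integral>\<^sup>+\<omega>. ennreal c \<partial>M)"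
    by (simp add: emeasure_space_1)
  also have "\<dots> \<le> (\<integral>\<^sup>+\<omega>. ennreal (\<psi> (card (children t (front t \<omega>) (draw t \<omega>)))) \<partial>M)"
  proof (rule markov_step_mono[where F = "\<lambda>_ _. ennreal c" and G = "\<lambda>A x. ennreal (\<psi> (card (children t A x)))"])
    fix A assume A: "A \<subseteq> {1..N}" "A \<noteq> {}"
    have "(\<Sum>y=0..N. trans_prob q N (card A) y * \<psi> y) = hit2 q N (card A)"
      by (simp add: sum.atLeast_Suc_atMost \<psi>_def hit2_def)
    thus "(\<integral>\<^sup>+\<omega>. ennreal c \<partial>M) \<le> (\<integral>\<^sup>+\<omega>. ennreal (\<psi> (card (children t A (draw t \<omega>)))) \<partial>M)"
      using c[OF card_pos[OF A]] nn_integral_children[OF A(1), of \<psi> t] \<psi>0 by (simp add: emeasure_space_1 ennreal_leI)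
  qed (simp_all only: measurable_card_children borel_measurable_const)
  also have "\<dots> \<le> (\<integral>\<^sup>+\<omega>. ennreal (q ^ (N * card (front (Suc t) \<omega>))) \<partial>M)"
  proof (rule nn_integral_mono_AE, use AE_le_k in eventually_elim)
    fix \<omega> assume le: "\<forall>i\<in>{1..N}. \<forall>j\<in>{1..N}. \<forall>s\<in>{1..}. xi i j s \<omega> \<le> k"
    show "ennreal (\<psi> (card (children t (front t \<omega>) (draw t \<omega>)))) \<le> ennreal (q ^ (N * card (front (Suc t) \<omega>)))"
      using front_survive[OF le, of t] finite_children by (auto simp: \<psi>_def)
  qed
  also have "\<dots> \<le> (\<integral>\<^sup>+\<omega>. ennreal (of_bool (card (children (Suc t) (front (Suc t) \<omega>) (draw (Suc t) \<omega>)) = 0)) \<partial>M)"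
  proof (rule markov_step_mono[where F = "\<lambda>A _. ennreal (q ^ (N * card A))"
      and G = "\<lambda>A x. ennreal (of_bool (card (children (Suc t) A x) = 0))"])
    fix A assume A: "A \<subseteq> {1..N}" "A \<noteq> {}"
    have "(\<Sum>y=0..N. trans_prob q N (card A) y * of_bool (y = 0)) = trans_prob q N (card A) 0"
      by (simp add: sum.atLeast_Suc_atMost)
    thus "(\<integral>\<^sup>+\<omega>. ennreal (q ^ (N * card A)) \<partial>M) \<le>
        (\<integral>\<^sup>+\<omega>. ennreal (of_bool (card (children (Suc t) A (draw (Suc t) \<omega>)) = 0)) \<partial>M)"
      using nn_integral_children[OF A(1), of "\<lambda>y. of_bool (y = 0)" "Suc t"]
      by (simp add: emeasure_space_1 trans_prob_def mult.commute flip: power_mult)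
  qed (simp_all only: measurable_card_children[where \<phi> = "\<lambda>y. of_bool (y = 0)"] borel_measurable_const)
  also have "\<dots> = (\<integral>\<^sup>+\<omega>. indicator E \<omega> \<partial>M)"
    using finite_children by (intro nn_integral_cong) (auto simp: E_def indicator_def)
  also have "\<dots> = ennreal (prob E)"
    using E by (simp add: emeasure_eq_measure)
  finally have cE: "c \<le> prob E"
    by (simp add: ennreal_le_iff)
  thus "c \<le> 1"
    using prob_le_1[of E] by linarith
  have "(\<integral>\<^sup>+\<omega>. ennreal (of_bool (children (Suc t) (front (Suc t) \<omega>) (draw (Suc t) \<omega>) \<noteq> {})) \<partial>M) =
      (\<integral>\<^sup>+\<omega>. indicator (space M - E) \<omega> \<partial>M)"
    by (intro nn_integral_cong) (auto simp: E_def indicator_def)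
  also have "\<dots> = ennreal (1 - prob E)"
    using E by (simp add: emeasure_eq_measure prob_compl)
  also have "\<dots> \<le> ennreal (1 - c)"
    using cE by (intro ennreal_leI) simp
  finally show "(\<integral>\<^sup>+\<omega>. ennreal (of_bool (children (Suc t) (front (Suc t) \<omega>) (draw (Suc t) \<omega>) \<noteq> {})) \<partial>M) \<le> ennreal (1 - c)" .
qed

text \<open>Each step gains at most k - 1, plus 1 if it survives. Counting survivals instead of
  losses gives an upper bound by nonnegative variables, the direction in which Fatou's lemma
  works.\<close>

lemma speed_le:
  assumes c: "\<And>z. z \<in> {1..N} \<Longrightarrow> c \<le> hit2 q N z"
    and lim: "AE \<omega> in M. (\<lambda>t. front_pos t \<omega> / real t) \<longlonglongrightarrow> v"
  shows "c \<le> real_of_int k - v"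
proof -
  note c1 = nn_integral_survive_le(2)[of c, OF c]
  define b where "b s \<omega> = (of_bool (children s (front s \<omega>) (draw s \<omega>) \<noteq> {}) :: real)" for s \<omega>
  have b_meas: "(\<lambda>\<omega>. ennreal (b s \<omega>)) \<in> borel_measurable M" for s
  proof -
    have "b s \<omega> = of_bool (card (children s (front s \<omega>) (draw s \<omega>)) \<noteq> 0)" for \<omega>
      using finite_children by (simp add: b_def)
    thus ?thesis
      using children_front_measurable[of "\<lambda>y. of_bool (y \<noteq> 0)" s] by simp
  qed
  \<comment> \<open>The estimate looks one step back, so step 0 is bounded trivially; its extra 1
    disappears on division by t.\<close>
  have bE: "(\<integral>\<^sup>+\<omega>. ennreal (b s \<omega>) \<partial>M) \<le> ennreal (of_bool (s = 0) + (1 - c))" for s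
  proof (cases s)
    case 0
    have "(\<integral>\<^sup>+\<omega>. ennreal (b s \<omega>) \<partial>M) \<le> (\<integral>\<^sup>+\<omega>. 1 \<partial>M)"
      by (intro nn_integral_mono) (simp add: b_def)
    also have "\<dots> \<le> ennreal (1 + (1 - c))"
      using c1 by (simp add: emeasure_space_1 del: ennreal_plus)
    finally show ?thesis using 0 by simp
  next
    case (Suc t)
    thus ?thesis
      using nn_integral_survive_le(1)[of c t, OF c] by (simp add: b_def)
  qed
  have pos: "front_pos t \<omega> \<le> (real_of_int k - 1) * real t + (\<Sum>s<t. b s \<omega>)"
    if le: "\<forall>i\<in>{1..N}. \<forall>j\<in>{1..N}. \<forall>s\<in>{1..}. xi i j s \<omega> \<le> k" for t \<omega>
  proof (induction t)
    case (Suc t)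
    have "front_pos (Suc t) \<omega> \<le> front_pos t \<omega> + (real_of_int k - 1) + b t \<omega>"
      using front_pos_extinct[OF le, of t] front_pos_survive[OF le, of t]
      by (cases "children t (front t \<omega>) (draw t \<omega>) = {}") (auto simp: b_def)
    thus ?case
      using Suc.IH by (simp add: algebra_simps)
  qed (simp add: front_pos_0)
  have "v - (real_of_int k - 1) \<le> 1 - c"
  proof (rule limit_le_of_nn_integral_le)
    show "(\<lambda>\<omega>. front_pos t \<omega> / real t - (real_of_int k - 1)) \<in> borel_measurable M" for t
      by measurable
    show "AE \<omega> in M. (\<lambda>t. front_pos t \<omega> / real t - (real_of_int k - 1)) \<longlonglongrightarrow> v - (real_of_int k - 1)"
      using lim by eventually_elim (intro tendsto_intros)
    show "\<forall>\<^sub>F t in sequentially. (\<integral>\<^sup>+\<omega>. ennreal (front_pos t \<omega> / real t - (real_of_int k - 1)) \<partial>M)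
        \<le> ennreal (1 / real t + (1 - c))"
      using eventually_gt_at_top[of 0]
    proof eventually_elim
      case (elim t)
      have "(\<integral>\<^sup>+\<omega>. ennreal (front_pos t \<omega> / real t - (real_of_int k - 1)) \<partial>M) \<le>
        (\<integral>\<^sup>+\<omega>. ennreal (1 / real t) * (\<Sum>s<t. ennreal (b s \<omega>)) \<partial>M)"
      proof (rule nn_integral_mono_AE, use AE_le_k in eventually_elim)
        fix \<omega> assume "\<forall>i\<in>{1..N}. \<forall>j\<in>{1..N}. \<forall>s\<in>{1..}. xi i j s \<omega> \<le> k"
        from divide_right_mono[OF pos[OF this, of t], of "real t"]
        have "front_pos t \<omega> / real t - (real_of_int k - 1) \<le> 1 / real t * (\<Sum>s<t. b s \<omega>)"
          using elim by (simp add: add_divide_distrib)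
        hence "ennreal (front_pos t \<omega> / real t - (real_of_int k - 1)) \<le> ennreal (1 / real t * (\<Sum>s<t. b s \<omega>))"
          by (rule ennreal_leI)
        also have "\<dots> = ennreal (1 / real t) * ennreal (\<Sum>s<t. b s \<omega>)"
          by (intro ennreal_mult sum_nonneg) (auto simp: b_def)
        also have "ennreal (\<Sum>s<t. b s \<omega>) = (\<Sum>s<t. ennreal (b s \<omega>))"
          by (intro sum_ennreal[symmetric]) (auto simp: b_def)
        finally show "ennreal (front_pos t \<omega> / real t - (real_of_int k - 1)) \<le>
          ennreal (1 / real t) * (\<Sum>s<t. ennreal (b s \<omega>))" .
      qed
      also have "\<dots> = ennreal (1 / real t) * (\<Sum>s<t. \<integral>\<^sup>+\<omega>. ennreal (b s \<omega>) \<partial>M)"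
        by (simp only: nn_integral_cmult[OF borel_measurable_sum[OF b_meas]] nn_integral_sum[OF b_meas])
      also have "\<dots> \<le> ennreal (1 / real t) * (\<Sum>s<t. ennreal (of_bool (s = 0) + (1 - c)))"
        by (intro mult_left_mono sum_mono bE) auto
      also have "(\<Sum>s<t. ennreal (of_bool (s = 0) + (1 - c))) = ennreal (\<Sum>s<t. of_bool (s = 0) + (1 - c))"
        using c1 by (intro sum_ennreal) auto
      also have "(\<Sum>s<t. of_bool (s = 0) + (1 - c)) = 1 + real t * (1 - c)"
        using elim by (simp add: sum.distrib of_bool_def sum.delta)
      also have "ennreal (1 / real t) * ennreal (1 + real t * (1 - c)) = ennreal (1 / real t + (1 - c))"
        using elim c1 by (simp add: ennreal_mult[symmetric] add_divide_distrib del: ennreal_plus)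
      finally show ?case .
    qed
    have "(\<lambda>t. 1 / real t) \<longlonglongrightarrow> 0"
      by (rule lim_const_over_n)
    thus "(\<lambda>t. 1 / real t + (1 - c)) \<longlonglongrightarrow> 1 - c"
      using tendsto_add[OF _ tendsto_const[of "1 - c"]] by fastforce
    show "0 \<le> 1 - c"
      using c1 by simp
  qed
  thus ?thesis by simp
qed

end

section \<open>Asymptotics of the speed\<close>

text \<open>The point masses are a density with respect to counting measure. This carries the mean
  condition on p over to the entries.\<close>

lemma (in prob_space) nn_integral_discrete:
  fixes X :: "'a \<Rightarrow> int" and g :: "int \<Rightarrow> ennreal"
  assumes X: "X \<in> measurable M (count_space UNIV)"
  shows "(\<integral>\<^sup>+\<omega>. g (X \<omega>) \<partial>M) = (\<integral>\<^sup>+l. ennreal (prob {\<omega> \<in> space M. X \<omega> = l}) * g l \<partial>count_space UNIV)"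
proof -
  have "distr M (count_space UNIV) X = density (count_space UNIV) (\<lambda>l. ennreal (prob {\<omega> \<in> space M. X \<omega> = l}))"
  proof (rule measure_eqI_countable[of _ UNIV])
    fix l :: int
    have "emeasure (distr M (count_space UNIV) X) {l} = emeasure M {\<omega> \<in> space M. X \<omega> = l}"
      using X by (auto simp: emeasure_distr intro!: arg_cong2[of _ _ _ _ emeasure])
    also have "\<dots> = ennreal (prob {\<omega> \<in> space M. X \<omega> = l})"
      by (rule emeasure_eq_measure)
    also have "\<dots> = emeasure (density (count_space UNIV) (\<lambda>l. ennreal (prob {\<omega> \<in> space M. X \<omega> = l}))) {l}"
      by (simp add: emeasure_density nn_integral_count_space_indicator[symmetric] nn_integral_count_space_finite)
    finally show "emeasure (distr M (count_space UNIV) X) {l} =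
      emeasure (density (count_space UNIV) (\<lambda>l. ennreal (prob {\<omega> \<in> space M. X \<omega> = l}))) {l}" .
  qed auto
  hence "(\<integral>\<^sup>+l. g l \<partial>distr M (count_space UNIV) X) =
      (\<integral>\<^sup>+l. ennreal (prob {\<omega> \<in> space M. X \<omega> = l}) * g l \<partial>count_space UNIV)"
    by (simp add: nn_integral_density)
  thus ?thesis
    using X by (simp add: nn_integral_distr)
qed

text \<open>The quotient of both sides is governed by \<open>(r / q) ^ (N * z - 1)\<close>, largest
  at z = 1. This makes losses larger than 1 negligible against losses of 1 at every nonzero
  state.\<close>

lemma eventually_power_le:
  fixes q r m e :: real
  assumes q: "0 < q" "q < 1" and r: "0 \<le> r" "r < q" and m: "0 \<le> m" and e: "0 < e"
  shows "\<forall>\<^sub>F N in sequentially. \<forall>z\<in>{1..N}. m * r ^ (N * z - 1) \<le> e * q ^ (N * z)"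
proof -
  have "(\<lambda>n. (r / q) ^ n) \<longlonglongrightarrow> 0"
    using q r by (intro LIMSEQ_realpow_zero) auto
  hence "(\<lambda>n. (r / q) ^ (n - 1)) \<longlonglongrightarrow> 0"
    using LIMSEQ_imp_Suc[of "\<lambda>n. (r / q) ^ (n - 1)" 0] by simp
  hence "(\<lambda>n. m / q * (r / q) ^ (n - 1)) \<longlonglongrightarrow> 0"
    by (rule tendsto_mult_right_zero)
  hence "\<forall>\<^sub>F N in sequentially. m / q * (r / q) ^ (N - 1) < e"
    using e by (intro order_tendstoD) auto
  thus ?thesis
    using eventually_gt_at_top[of 0]
  proof eventually_elim
    case (elim N)
    show ?case
    proof
      fix z assume z: "z \<in> {1..N}"
      hence n: "N \<le> N * z" "0 < N * z" using elim by auto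
      have "m * r ^ (N * z - 1) = m / q * (r / q) ^ (N * z - 1) * (q * q ^ (N * z - 1))"
        using q by (simp add: power_divide)
      also have "q * q ^ (N * z - 1) = q ^ (N * z)"
        using n by (simp flip: power_Suc)
      also have "m / q * (r / q) ^ (N * z - 1) * q ^ (N * z) \<le> m / q * (r / q) ^ (N - 1) * q ^ (N * z)"
        using q r m diff_le_mono[OF n(1)] by (intro mult_right_mono mult_left_mono power_decreasing) auto
      also have "\<dots> \<le> e * q ^ (N * z)"
        using elim q by (intro mult_right_mono) auto
      finally show "m * r ^ (N * z - 1) \<le> e * q ^ (N * z)" .
    qed
  qed
qed

text \<open>On the support k - l is at most |k| + |l|, so the mean deficit is dominated by the total
  mass and the absolute mean.\<close>

lemma nn_integral_count_space_finite_mean: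
  fixes p :: "int \<Rightarrow> real"
  assumes p0: "\<And>l. 0 \<le> p l" and supp: "\<And>l. l > k \<Longrightarrow> p l = 0"
    and sum: "p summable_on {..k}" and mean: "(\<lambda>l. \<bar>real_of_int l\<bar> * p l) summable_on {..k}"
  shows "(\<integral>\<^sup>+l. ennreal (p l) * ennreal (real_of_int (k - l)) \<partial>count_space UNIV) < \<infinity>"
proof -
  define h where "h l = \<bar>real_of_int k\<bar> * p l + \<bar>real_of_int l\<bar> * p l" for l
  have h0: "0 \<le> h l" for l
    using p0 by (simp add: h_def)
  have "h summable_on {..k}"
    unfolding h_def by (intro summable_on_add summable_on_cmult_right sum mean)
  hence "h summable_on UNIV"
    by (rule iffD1[OF summable_on_cong_neutral, rotated -1]) (auto simp: h_def supp)
  hence "Infinite_Sum.abs_summable_on h UNIV"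
    using h0 by simp
  hence "integrable (count_space UNIV) h"
    using abs_summable_equivalent[of h UNIV] by (simp add: abs_summable_on_def)
  hence fin: "(\<integral>\<^sup>+l. ennreal (h l) \<partial>count_space UNIV) < \<infinity>"
    using h0 by (simp add: nn_integral_eq_integral)
  have "(\<integral>\<^sup>+l. ennreal (p l) * ennreal (real_of_int (k - l)) \<partial>count_space UNIV) \<le> (\<integral>\<^sup>+l. ennreal (h l) \<partial>count_space UNIV)"
  proof (intro nn_integral_mono)
    fix l :: int
    have "p l * real_of_int (k - l) \<le> p l * (\<bar>real_of_int k\<bar> + \<bar>real_of_int l\<bar>)"
      using p0 by (intro mult_left_mono) auto
    thus "ennreal (p l) * ennreal (real_of_int (k - l)) \<le> ennreal (h l)"
      unfolding ennreal_mult'[OF p0, symmetric] by (intro ennreal_leI) (simp add: h_def algebra_simps)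
  qed
  thus ?thesis
    using fin by (rule le_less_trans)
qed

theorem theorem6p1:
  fixes M :: "'a measure"
    and k :: int
    and p :: "int \<Rightarrow> real"
    and xi :: "nat \<Rightarrow> nat \<Rightarrow> nat \<Rightarrow> nat \<Rightarrow> 'a \<Rightarrow> int"
    and X0 :: "nat \<Rightarrow> nat \<Rightarrow> real"
    and v :: "nat \<Rightarrow> real"
  assumes "prob_space M"
    and p_nonneg: "\<And>l. p l \<ge> 0"
    and p_supp: "\<And>l. l > k \<Longrightarrow> p l = 0"
    and p_sum: "(p has_sum 1) {..k}"
    and pk: "0 < p k" "p k < 1"
    and pk1: "p k * p (k - 1) > 0"
    and mean: "(\<lambda>l. \<bar>real_of_int l\<bar> * p l) summable_on {..k}"
    and rv: "\<And>N i j s. xi N i j s \<in> measurable M (count_space UNIV)"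
    and law: "\<And>N i j s l. N \<ge> 1 \<Longrightarrow> i \<in> {1..N} \<Longrightarrow> j \<in> {1..N} \<Longrightarrow> s \<ge> 1 \<Longrightarrow>
                 measure M {\<omega> \<in> space M. xi N i j s \<omega> = l} = p l"
    and iid: "\<And>N. N \<ge> 1 \<Longrightarrow> prob_space.indep_vars M (\<lambda>_. count_space UNIV)
                 (\<lambda>(i, j, s). xi N i j s) {(i, j, s). i \<in> {1..N} \<and> j \<in> {1..N} \<and> s \<ge> 1}"
    and v_lim: "\<And>N. N \<ge> 1 \<Longrightarrow> AE \<omega> in M.
                 (\<lambda>t. Max ((\<lambda>i. maxplus_proc N (X0 N) (\<lambda>i j s. xi N i j s \<omega>) t i) ` {1..N}) / real t)
                   \<longlonglongrightarrow> v N"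
  shows "(\<lambda>N. v N - (real_of_int k - (1 - p k) ^ (N ^ 2) * 2 ^ N))
           \<in> o(\<lambda>N. (1 - p k) ^ (N ^ 2) * 2 ^ N)"
proof -
  interpret prob_space M by fact
  define q where "q = 1 - p k"
  define r where "r = 1 - p k - p (k - 1)"
  define m where "m = enn2real (\<integral>\<^sup>+l. ennreal (p l) * ennreal (real_of_int (k - l)) \<partial>count_space UNIV)"
  define a where "a N = q ^ N\<^sup>2 * 2 ^ N" for N
  have q: "0 < q" "q < 1"
    using pk by (auto simp: q_def)
  \<comment> \<open>This is where \<open>pk1\<close> acts: it makes r strictly smaller than
    q.\<close>
  have "p (k - 1) > 0"
    using pk1 pk by (simp add: zero_less_mult_iff)
  hence rq: "r < q"
    by (simp add: r_def q_def)
  have m0: "0 \<le> m"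
    by (simp add: m_def)
  \<comment> \<open>Finiteness is essential: at infinity \<open>enn2real\<close> would return the
    default 0.\<close>
  have I_eq: "(\<integral>\<^sup>+l. ennreal (p l) * ennreal (real_of_int (k - l)) \<partial>count_space UNIV) = ennreal m"
    using nn_integral_count_space_finite_mean[OF p_nonneg p_supp has_sum_imp_summable[OF p_sum] mean]
    by (simp add: m_def)
  have model: "maxplus_model M N k (xi N) q r m" if N: "N \<ge> 1" for N
  proof unfold_locales
    show "indep_vars (\<lambda>_. count_space UNIV) (\<lambda>(i, j, s). xi N i j s) ({1..N} \<times> {1..N} \<times> {1..})"
      using iid[OF N] by (rule iffD1[OF indep_vars_cong, rotated -1]) auto
    fix i j s :: nat assume ijs: "i \<in> {1..N}" "j \<in> {1..N}" "s \<ge> 1"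
    note L = law[OF N ijs]
    have S: "{\<omega> \<in> space M. xi N i j s \<omega> = l} \<in> sets M" for l
      by (rule measurable_sets_Collect[OF rv, of "\<lambda>v. v = l"]) simp
    show "prob {\<omega> \<in> space M. xi N i j s \<omega> \<noteq> k} = q"
      using prob_neg[OF S, of k] L by (simp add: q_def)
    have "prob {\<omega> \<in> space M. xi N i j s \<omega> \<notin> {k, k - 1}} =
        prob (space M - ({\<omega> \<in> space M. xi N i j s \<omega> = k} \<union> {\<omega> \<in> space M. xi N i j s \<omega> = k - 1}))"
      by (rule arg_cong[of _ _ prob]) auto
    also have "\<dots> = 1 - prob ({\<omega> \<in> space M. xi N i j s \<omega> = k} \<union> {\<omega> \<in> space M. xi N i j s \<omega> = k - 1})"
      by (intro prob_compl sets.Un S)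
    also have "prob ({\<omega> \<in> space M. xi N i j s \<omega> = k} \<union> {\<omega> \<in> space M. xi N i j s \<omega> = k - 1}) = p k + p (k - 1)"
      using L by (subst finite_measure_Union[OF S S]) auto
    finally show "prob {\<omega> \<in> space M. xi N i j s \<omega> \<notin> {k, k - 1}} = r"
      by (simp add: r_def)
    have "AE \<omega> in M. \<forall>l. l > k \<longrightarrow> xi N i j s \<omega> \<noteq> l"
    proof (subst AE_all_countable, rule allI)
      fix l
      have "AE \<omega> in M. xi N i j s \<omega> \<noteq> l" if "l > k"
        using prob_neg[OF S, of l] L[of l] p_supp[OF that] measurable_sets_Collect[OF rv, of "\<lambda>v. v \<noteq> l" N i j s]
        by (subst prob_Collect_eq_1[symmetric]) auto
      thus "AE \<omega> in M. l > k \<longrightarrow> xi N i j s \<omega> \<noteq> l"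
        by (cases "l > k") auto
    qed
    thus "AE \<omega> in M. xi N i j s \<omega> \<le> k"
      by eventually_elim force
    show "(\<integral>\<^sup>+\<omega>. ennreal (real_of_int (k - xi N i j s \<omega>)) \<partial>M) \<le> ennreal m"
      using nn_integral_discrete[OF rv, of "\<lambda>l. ennreal (real_of_int (k - l))" N i j s] I_eq L by simp
  qed (use N rv m0 in auto)
  \<comment> \<open>The case N = 1 supplies a model in which r is a probability, hence
    nonnegative.\<close>
  interpret M1: maxplus_model M 1 k "xi 1" q r m
    by (rule model) simp
  have r0: "0 \<le> r"
    by (rule M1.r_nonneg)
  have lim: "AE \<omega> in M. (\<lambda>t. maxplus_model.front_pos N (xi N) t \<omega> / real t) \<longlonglongrightarrow> v N" if N: "N \<ge> 1" for N
    using v_lim[OF N]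
  proof eventually_elim
    fix \<omega>
    assume "(\<lambda>t. Max ((\<lambda>i. maxplus_proc N (X0 N) (\<lambda>i j s. xi N i j s \<omega>) t i) ` {1..N}) / real t) \<longlonglongrightarrow> v N"
    hence "(\<lambda>t. top_pos N (X0 N) (\<lambda>i j s. xi N i j s \<omega>) t / real t) \<longlonglongrightarrow> v N"
      by (simp only: top_pos_def)
    from top_pos_limit_zero_start[OF N this]
    moreover have "maxplus_model.env (xi N) \<omega> = (\<lambda>i j s. xi N i j s \<omega>)"
      by (intro ext maxplus_model.env_def[OF model[OF N]])
    ultimately show "(\<lambda>t. maxplus_model.front_pos N (xi N) t \<omega> / real t) \<longlonglongrightarrow> v N"
      using maxplus_model.front_pos_def[OF model[OF N]] by simp
  qed
  have "(\<lambda>N. v N - (real_of_int k - a N)) \<in> o(a)"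
  proof (rule landau_o.smallI)
    fix c :: real assume c: "c > 0"
    \<comment> \<open>For e \<le> 1 the product (1 + 2 e) (1 + e) is at most 1 + 5 e, whence the
      5.\<close>
    define e where "e = min 1 (c / 5)"
    have e: "0 < e" "e \<le> 1" "5 * e \<le> c"
      using c by (auto simp: e_def)
    have ec: "(1 + 2 * e) * (1 + e) \<le> 1 + c"
    proof -
      have "(1 + 2 * e) * (1 + e) = 1 + 3 * e + 2 * (e * e)"
        by (simp add: algebra_simps)
      also have "e * e \<le> e * 1"
        using e by (intro mult_left_mono) auto
      finally show ?thesis using e by linarith
    qed
    show "\<forall>\<^sub>F N in sequentially. norm (v N - (real_of_int k - a N)) \<le> c * norm (a N)"
      using eventually_hit2_ge[OF q c] eventually_lyapunov[OF q e(1,2)]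
        eventually_power_le[OF q r0 rq m0 e(1)] eventually_ge_at_top[of 1]
    proof eventually_elim
      case (elim N)
      interpret N: maxplus_model M N k "xi N" q r m
        using elim by (intro model)
      note l = lim[OF elim(4)]
      have a0: "0 \<le> a N"
        using q by (simp add: a_def)
      have lower: "(1 - c) * a N \<le> real_of_int k - v N"
        using elim(1) l unfolding a_def by (intro N.speed_le) auto
      obtain H :: "nat \<Rightarrow> real" where H: "\<And>y. 0 \<le> H y" "\<And>y. y \<in> {1..N} \<Longrightarrow> H y \<le> e"
        "\<And>z. z \<in> {1..N} \<Longrightarrow> q ^ (N * z) * (1 + 2 * e) + (\<Sum>y=1..N. trans_prob q N z y * H y)
           \<le> H z + (1 + 2 * e) * (1 + e) * a N"
        using elim(2) unfolding a_def by blast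
      \<comment> \<open>Here K = e. One e in the factor 1 + 2 e pays for the state after a loss, the
        other absorbs the term \<open>m * r ^ (N * z - 1)\<close>.\<close>
      have "real_of_int k - v N \<le> (1 + 2 * e) * (1 + e) * a N"
      proof (rule N.speed_ge)
        fix z assume z: "z \<in> {1..N}"
        have "m * r ^ (N * z - 1) \<le> e * q ^ (N * z)"
          using elim(3) z by blast
        thus "q ^ (N * z) * (1 + e) + m * r ^ (N * z - 1) + (\<Sum>y=1..N. trans_prob q N z y * H y)
            \<le> H z + (1 + 2 * e) * (1 + e) * a N"
          using H(3)[OF z] by (simp add: algebra_simps)
      qed (use H e a0 l in auto)
      also have "\<dots> \<le> (1 + c) * a N"
        using ec a0 by (rule mult_right_mono)
      finally show ?case
        using lower a0 by (simp add: abs_le_iff algebra_simps)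
    qed
  qed
  thus ?thesis
    by (simp add: a_def[abs_def] q_def)
qed

end
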